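(* Let $\iota: R\to A$ be a Frobenius extension and let $e\in R$ be an idempotent. If $Ae\in\operatorname{add}_R(Re)$ as a restricted left $R$-module, then the natural ring homomorphism $eRe\to eAe$ induced by $\iota$ is a Frobenius extension. In particular, the conclusion holds for every idempotent $e\in R$ if $\iota: R\to A$ is centrally projective.
   Context: All rings are associative with unit; modules are left modules unless otherwise specified. A ring extension $\iota:R\to A$ is a unital ring homomorphism, and $A$-modules are viewed as $R$-modules by restriction along $\iota$. It is a Frobenius extension if $A$ is finitely generated projective as a left $R$-module and $A\cong\operatorname{Hom}_R(A,R)$ as $A$-$R$-bimodules, where $(af)(x)=f(xa)$ and $(fr)(x)=f(x)r$. A Frobenius extension is centrally projective if ${}_RA_R$ is isomorphic, as an $R$-$R$-bimodule, to a direct summand of $R^n$ for some $n\geq 1$. For an $R$-module $M$, $\operatorname{add}_R(M)$ is the class of direct summands of finite direct sums of copies of $M$. The notation $Ae$ and $eAe$ means $A\iota(e)$ and $\iota(e)A\iota(e)$; the rings $eRe$ and $eAe$ have identities $e$ and $\iota(e)$. *)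

theory Defs
  imports "HOL-Algebra.Module" "HOL-Algebra.RingHom"
begin

section \<open>Modules and bimodules over noncommutative rings\<close>

text \<open>
  The library locale \<^locale>\<open>module\<close> demands a commutative base ring, so left modules are
  introduced here; the record type and the locale \<^locale>\<open>submodule\<close> are reused, since neither
  involves commutativity. The \<open>mult\<close> and \<open>one\<close> fields inherited by a module record carry no
  meaning.
\<close>

locale left_module = R?: ring R + M?: abelian_group M
  for R :: "('r, 'k) ring_scheme" (structure) and M :: "('r, 'm, 'x) module_scheme" (structure) +
  assumes smult_closed:
      "\<lbrakk>a \<in> carrier R; x \<in> carrier M\<rbrakk> \<Longrightarrow> a \<odot>\<^bsub>M\<^esub> x \<in> carrier M"
    and smult_l_distr:
      "\<lbrakk>a \<in> carrier R; b \<in> carrier R; x \<in> carrier M\<rbrakk> \<Longrightarrow>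
        (a \<oplus> b) \<odot>\<^bsub>M\<^esub> x = a \<odot>\<^bsub>M\<^esub> x \<oplus>\<^bsub>M\<^esub> b \<odot>\<^bsub>M\<^esub> x"
    and smult_r_distr:
      "\<lbrakk>a \<in> carrier R; x \<in> carrier M; y \<in> carrier M\<rbrakk> \<Longrightarrow>
        a \<odot>\<^bsub>M\<^esub> (x \<oplus>\<^bsub>M\<^esub> y) = a \<odot>\<^bsub>M\<^esub> x \<oplus>\<^bsub>M\<^esub> a \<odot>\<^bsub>M\<^esub> y"
    and smult_assoc:
      "\<lbrakk>a \<in> carrier R; b \<in> carrier R; x \<in> carrier M\<rbrakk> \<Longrightarrow>
        (a \<otimes> b) \<odot>\<^bsub>M\<^esub> x = a \<odot>\<^bsub>M\<^esub> (b \<odot>\<^bsub>M\<^esub> x)"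
    and smult_one: "x \<in> carrier M \<Longrightarrow> \<one> \<odot>\<^bsub>M\<^esub> x = x"

record ('r, 's, 'm) bimodule = "('r, 'm) module" +
  rsmult :: "['m, 's] \<Rightarrow> 'm" (infixl \<open>\<triangleleft>\<index>\<close> 70)

definition left_hom ::
  "('r, 'k) ring_scheme \<Rightarrow> ('r, 'm, 'x) module_scheme \<Rightarrow> ('r, 'n, 'y) module_scheme \<Rightarrow> ('m \<Rightarrow> 'n) set"
  where "left_hom R M N = {f \<in> hom (add_monoid M) (add_monoid N).
    \<forall>a\<in>carrier R. \<forall>x\<in>carrier M. f (a \<odot>\<^bsub>M\<^esub> x) = a \<odot>\<^bsub>N\<^esub> f x}"

definition left_isomorphic ::
  "('r, 'k) ring_scheme \<Rightarrow> ('r, 'm, 'x) module_scheme \<Rightarrow> ('r, 'n, 'y) module_scheme \<Rightarrow> bool"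
  where "left_isomorphic R M N \<longleftrightarrow>
    (\<exists>f\<in>left_hom R M N. bij_betw f (carrier M) (carrier N))"

definition bimodule_isomorphic ::
  "('r, 'k) ring_scheme \<Rightarrow> ('s, 'l) ring_scheme \<Rightarrow>
    ('r, 's, 'm, 'x) bimodule_scheme \<Rightarrow> ('r, 's, 'n, 'y) bimodule_scheme \<Rightarrow> bool"
  where "bimodule_isomorphic R S M N \<longleftrightarrow>
    (\<exists>f\<in>left_hom R M N. bij_betw f (carrier M) (carrier N) \<and>
      (\<forall>x\<in>carrier M. \<forall>s\<in>carrier S. f (x \<triangleleft>\<^bsub>M\<^esub> s) = f x \<triangleleft>\<^bsub>N\<^esub> s))"

subsection \<open>Direct summands of finite powers\<close>

definition left_direct_summand ::
  "'m set \<Rightarrow> ('r, 'k) ring_scheme \<Rightarrow> ('r, 'm, 'x) module_scheme \<Rightarrow> bool"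
  where "left_direct_summand K R M \<longleftrightarrow> submodule K R M \<and>
    (\<exists>L. submodule L R M \<and> K <+>\<^bsub>M\<^esub> L = carrier M \<and> K \<inter> L = {\<zero>\<^bsub>M\<^esub>})"

definition subbimodule ::
  "'m set \<Rightarrow> ('r, 'k) ring_scheme \<Rightarrow> ('s, 'l) ring_scheme \<Rightarrow>
    ('r, 's, 'm, 'x) bimodule_scheme \<Rightarrow> bool"
  where "subbimodule K R S M \<longleftrightarrow> submodule K R M \<and>
    (\<forall>x\<in>K. \<forall>s\<in>carrier S. x \<triangleleft>\<^bsub>M\<^esub> s \<in> K)"

definition bimodule_direct_summand ::
  "'m set \<Rightarrow> ('r, 'k) ring_scheme \<Rightarrow> ('s, 'l) ring_scheme \<Rightarrow>
    ('r, 's, 'm, 'x) bimodule_scheme \<Rightarrow> bool"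
  where "bimodule_direct_summand K R S M \<longleftrightarrow> subbimodule K R S M \<and>
    (\<exists>L. subbimodule L R S M \<and> K <+>\<^bsub>M\<^esub> L = carrier M \<and> K \<inter> L = {\<zero>\<^bsub>M\<^esub>})"

definition module_power :: "('r, 'm, 'x) module_scheme \<Rightarrow> nat \<Rightarrow> ('r, nat \<Rightarrow> 'm) module"
  where "module_power M n =
    \<lparr>carrier = {..<n} \<rightarrow>\<^sub>E carrier M,
     mult = undefined, one = undefined,
     zero = (\<lambda>i\<in>{..<n}. \<zero>\<^bsub>M\<^esub>),
     add = (\<lambda>x y. \<lambda>i\<in>{..<n}. x i \<oplus>\<^bsub>M\<^esub> y i),
     smult = (\<lambda>a x. \<lambda>i\<in>{..<n}. a \<odot>\<^bsub>M\<^esub> x i)\<rparr>"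

definition bimodule_power ::
  "('r, 's, 'm, 'x) bimodule_scheme \<Rightarrow> nat \<Rightarrow> ('r, 's, nat \<Rightarrow> 'm) bimodule"
  where "bimodule_power M n = module.extend (module_power M n)
    (bimodule.fields (\<lambda>x s. \<lambda>i\<in>{..<n}. x i \<triangleleft>\<^bsub>M\<^esub> s))"

text \<open>\<open>in_add R M N\<close> says that \<open>N\<close> belongs to \<open>add\<^sub>R(M)\<close>.\<close>

definition in_add ::
  "('r, 'k) ring_scheme \<Rightarrow> ('r, 'm, 'x) module_scheme \<Rightarrow> ('r, 'n, 'y) module_scheme \<Rightarrow> bool"
  where "in_add R M N \<longleftrightarrow>
    (\<exists>n K. left_direct_summand K R (module_power M n) \<and>
      left_isomorphic R N ((module_power M n)\<lparr>carrier := K\<rparr>))"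

subsection \<open>Finitely generated and projective modules\<close>

definition finitely_generated ::
  "('r, 'k) ring_scheme \<Rightarrow> ('r, 'm, 'x) module_scheme \<Rightarrow> bool"
  where "finitely_generated R M \<longleftrightarrow>
    (\<exists>G. finite G \<and> G \<subseteq> carrier M \<and>
      (\<forall>x\<in>carrier M. \<exists>c\<in>G \<rightarrow> carrier R. x = (\<Oplus>\<^bsub>M\<^esub>g\<in>G. c g \<odot>\<^bsub>M\<^esub> g)))"

text \<open>
  The lifting property. A definition cannot quantify over types, so the test modules \<open>N\<close> and \<open>P\<close>
  live on fixed types. This loses nothing: the choice \<open>P = M\<close> with \<open>N\<close> the free module on the
  underlying set of \<open>M\<close> (finitely supported functions from \<open>M\<close> to \<open>R\<close>) is admissible and already
  exhibits \<open>M\<close> as a direct summand of a free module, whence lifting against all surjections.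
\<close>

definition projective ::
  "('r, 'k) ring_scheme \<Rightarrow> ('r, 'm, 'x) module_scheme \<Rightarrow> bool"
  where "projective R M \<longleftrightarrow>
    (\<forall>(N :: ('r, 'm \<Rightarrow> 'r) module) (P :: ('r, 'm) module) p f.
      left_module R N \<and> left_module R P \<and>
      p \<in> left_hom R N P \<and> p ` carrier N = carrier P \<and> f \<in> left_hom R M P \<longrightarrow>
      (\<exists>h\<in>left_hom R M N. \<forall>x\<in>carrier M. p (h x) = f x))"

subsection \<open>Rings as modules\<close>

definition regular_bimodule :: "('a, 'k) ring_scheme \<Rightarrow> ('a, 'a, 'a) bimodule"
  where "regular_bimodule A =
    \<lparr>carrier = carrier A, mult = mult A, one = one A, zero = zero A, add = add A,
     smult = mult A, rsmult = mult A\<rparr>"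

definition left_ideal_module :: "('a, 'k) ring_scheme \<Rightarrow> 'a \<Rightarrow> ('a, 'a) module"
  where "left_ideal_module A e =
    \<lparr>carrier = (\<lambda>a. a \<otimes>\<^bsub>A\<^esub> e) ` carrier A, mult = undefined, one = undefined,
     zero = zero A, add = add A, smult = mult A\<rparr>"

definition restrict_scalars ::
  "('r \<Rightarrow> 'a) \<Rightarrow> ('a, 'm, 'x) module_scheme \<Rightarrow> ('r, 'm) module"
  where "restrict_scalars \<iota> M =
    \<lparr>carrier = carrier M, mult = mult M, one = one M, zero = zero M, add = add M,
     smult = (\<lambda>r x. \<iota> r \<odot>\<^bsub>M\<^esub> x)\<rparr>"

definition restrict_biscalars ::
  "('r \<Rightarrow> 'a) \<Rightarrow> ('s \<Rightarrow> 'b) \<Rightarrow> ('a, 'b, 'm, 'x) bimodule_scheme \<Rightarrow> ('r, 's, 'm) bimodule"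
  where "restrict_biscalars \<iota> \<kappa> M = module.extend (restrict_scalars \<iota> M)
    (bimodule.fields (\<lambda>x s. x \<triangleleft>\<^bsub>M\<^esub> \<kappa> s))"

text \<open>
  For an \<open>R\<close>-\<open>A\<close>-bimodule \<open>M\<close> and an \<open>R\<close>-\<open>S\<close>-bimodule \<open>N\<close>, the \<open>A\<close>-\<open>S\<close>-bimodule
  \<open>Hom\<^sub>R(M, N)\<close> of left \<open>R\<close>-linear maps with \<open>(a f)(x) = f (x a)\<close> and \<open>(f s)(x) = f(x) s\<close>.
  Maps are \<^const>\<open>extensional\<close>, so that equality of elements is equality on \<open>M\<close>.
\<close>

definition Hom_bimodule ::
  "('r, 'k) ring_scheme \<Rightarrow> ('r, 'a, 'm, 'x) bimodule_scheme \<Rightarrow> ('r, 's, 'n, 'y) bimodule_scheme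
    \<Rightarrow> ('a, 's, 'm \<Rightarrow> 'n) bimodule"
  where "Hom_bimodule R M N =
    \<lparr>carrier = left_hom R M N \<inter> extensional (carrier M),
     mult = undefined, one = undefined,
     zero = (\<lambda>x\<in>carrier M. \<zero>\<^bsub>N\<^esub>),
     add = (\<lambda>f g. \<lambda>x\<in>carrier M. f x \<oplus>\<^bsub>N\<^esub> g x),
     smult = (\<lambda>a f. \<lambda>x\<in>carrier M. f (x \<triangleleft>\<^bsub>M\<^esub> a)),
     rsmult = (\<lambda>f s. \<lambda>x\<in>carrier M. f x \<triangleleft>\<^bsub>N\<^esub> s)\<rparr>"

section \<open>Frobenius extensions\<close>

definition frobenius_extension ::
  "('r, 'k) ring_scheme \<Rightarrow> ('a, 'l) ring_scheme \<Rightarrow> ('r \<Rightarrow> 'a) \<Rightarrow> bool"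
  where "frobenius_extension R A \<iota> \<longleftrightarrow>
    ring_hom_ring R A \<iota> \<and>
    finitely_generated R (restrict_scalars \<iota> (regular_bimodule A)) \<and>
    projective R (restrict_scalars \<iota> (regular_bimodule A)) \<and>
    bimodule_isomorphic A R
      (restrict_biscalars id \<iota> (regular_bimodule A))
      (Hom_bimodule R (restrict_biscalars \<iota> id (regular_bimodule A)) (regular_bimodule R))"

definition centrally_projective ::
  "('r, 'k) ring_scheme \<Rightarrow> ('a, 'l) ring_scheme \<Rightarrow> ('r \<Rightarrow> 'a) \<Rightarrow> bool"
  where "centrally_projective R A \<iota> \<longleftrightarrow>
    (\<exists>n\<ge>1. \<exists>K. bimodule_direct_summand K R R (bimodule_power (regular_bimodule R) n) \<and>
      bimodule_isomorphic R R
        (restrict_biscalars \<iota> \<iota> (regular_bimodule A))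
        ((bimodule_power (regular_bimodule R) n)\<lparr>carrier := K\<rparr>))"

definition corner_ring :: "('a, 'k) ring_scheme \<Rightarrow> 'a \<Rightarrow> ('a, 'k) ring_scheme"
  where "corner_ring A e =
    A\<lparr>carrier := (\<lambda>a. e \<otimes>\<^bsub>A\<^esub> a \<otimes>\<^bsub>A\<^esub> e) ` carrier A, one := e\<rparr>"

end

theory Submission
  imports Defs
begin

text \<open>
  The image of \<open>1\<close> under an isomorphism \<open>A \<cong> Hom\<^sub>R(A, R)\<close> is an \<open>R\<close>-\<open>R\<close>-bilinear form \<open>E : A \<rightarrow> R\<close>
  such that \<open>a \<mapsto> E(- a)\<close> is that isomorphism. The form restricts to \<open>eAe \<rightarrow> eRe\<close>. If \<open>Ae\<close> is a
  summand of \<open>(Re)\<^sup>n\<close>, then \<open>x = \<Sum> u\<^sub>j(x) v\<^sub>j\<close> on \<open>Ae\<close> for some \<open>R\<close>-linear \<open>u\<^sub>j : Ae \<rightarrow> Re\<close> and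
  \<open>v\<^sub>j \<in> eAe\<close>. Extending \<open>u\<^sub>j\<close> along \<open>x \<mapsto> xe\<close> to \<open>A\<close> represents it as \<open>E(- w\<^sub>j)\<close>, and \<open>w\<^sub>j\<close> may be
  replaced by \<open>e w\<^sub>j e\<close>, so that \<open>x = \<Sum> E(x w\<^sub>j) v\<^sub>j\<close> on \<open>eAe\<close>. These dual bases make \<open>eAe\<close> finitely
  generated projective over \<open>eRe\<close> and every linear map representable, while nondegeneracy of \<open>E\<close> on
  \<open>eAe\<close> follows from \<open>E(x y) = \<Sum> u\<^sub>j(xe) E(v\<^sub>j y)\<close> for \<open>x \<in> A\<close> and \<open>y \<in> eAe\<close>. If \<open>A\<close> is
  isomorphic to a bimodule summand \<open>K\<close> of \<open>R\<^sup>n\<close>, then \<open>Ae\<close> corresponds to the summand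
  \<open>Ke = K \<inter> (Re)\<^sup>n\<close> of \<open>(Re)\<^sup>n\<close>.
\<close>

section \<open>Left modules\<close>

text \<open>The two records may carry different extra fields, so one subgroup argument serves the
  regular module, restriction of scalars, left ideals and corner rings alike.\<close>

lemma abelian_group_restrict_carrier:
  fixes M :: "('m, 'x) ring_scheme" and N :: "('m, 'y) ring_scheme"
  assumes "abelian_group M" "subgroup (carrier N) (add_monoid M)" "zero N = zero M" "add N = add M"
  shows "abelian_group N"
proof -
  interpret M: abelian_group M by fact
  have sub: "carrier N \<subseteq> carrier M"
    and closed: "\<And>x y. x \<in> carrier N \<Longrightarrow> y \<in> carrier N \<Longrightarrow> x \<oplus>\<^bsub>M\<^esub> y \<in> carrier N"
    and zero: "\<zero>\<^bsub>M\<^esub> \<in> carrier N"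
    and inv: "\<And>x. x \<in> carrier N \<Longrightarrow> \<ominus>\<^bsub>M\<^esub> x \<in> carrier N"
    using assms(2) unfolding subgroup_def a_inv_def by auto
  show ?thesis
  proof (rule abelian_groupI)
    fix x assume x: "x \<in> carrier N"
    show "\<exists>y\<in>carrier N. y \<oplus>\<^bsub>N\<^esub> x = \<zero>\<^bsub>N\<^esub>"
      using x inv[OF x] sub assms by (auto intro!: bexI[of _ "\<ominus>\<^bsub>M\<^esub> x"] M.l_neg)
  qed (use sub closed zero assms(3,4) in \<open>auto simp: subset_iff M.a_assoc M.a_comm M.a_lcomm\<close>)
qed

text \<open>Induction on \<open>I\<close>; over an infinite index set both sums are zero by
  convention. Taking \<open>f\<close> to be the identity identifies sums in two records that share
  an addition but differ in their other fields.\<close>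

lemma additive_finsum:
  assumes "abelian_group M" "abelian_group N" "f \<in> hom (add_monoid M) (add_monoid N)"
    and "g \<in> I \<rightarrow> carrier M"
  shows "f (\<Oplus>\<^bsub>M\<^esub>i\<in>I. g i) = (\<Oplus>\<^bsub>N\<^esub>i\<in>I. f (g i))"
proof -
  interpret abelian_group_hom M N f
    using assms by (simp add: abelian_group_homI group_hom_def group_hom_axioms_def abelian_group.a_group)
  show ?thesis
    using assms(4)
  proof (induction I rule: infinite_finite_induct)
    case (infinite I)
    then show ?case by simp
  next
    case empty
    then show ?case by simp
  next
    case (insert i I)
    then show ?case
      by (subst G.finsum_insert; (subst H.finsum_insert)?) (auto simp: Pi_def)
  qed
qed

lemma left_homI:
  assumes "\<And>x. x \<in> carrier M \<Longrightarrow> f x \<in> carrier N"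
    and "\<And>x y. x \<in> carrier M \<Longrightarrow> y \<in> carrier M \<Longrightarrow> f (x \<oplus>\<^bsub>M\<^esub> y) = f x \<oplus>\<^bsub>N\<^esub> f y"
    and "\<And>a x. a \<in> carrier R \<Longrightarrow> x \<in> carrier M \<Longrightarrow> f (a \<odot>\<^bsub>M\<^esub> x) = a \<odot>\<^bsub>N\<^esub> f x"
  shows "f \<in> left_hom R M N"
  using assms by (auto simp: left_hom_def hom_def)

lemma left_homD:
  assumes "f \<in> left_hom R M N"
  shows left_hom_closed: "\<And>x. x \<in> carrier M \<Longrightarrow> f x \<in> carrier N"
    and left_hom_add: "\<And>x y. x \<in> carrier M \<Longrightarrow> y \<in> carrier M \<Longrightarrow> f (x \<oplus>\<^bsub>M\<^esub> y) = f x \<oplus>\<^bsub>N\<^esub> f y"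
    and left_hom_smult: "\<And>a x. a \<in> carrier R \<Longrightarrow> x \<in> carrier M \<Longrightarrow> f (a \<odot>\<^bsub>M\<^esub> x) = a \<odot>\<^bsub>N\<^esub> f x"
    and left_hom_additive: "f \<in> hom (add_monoid M) (add_monoid N)"
  using assms by (auto simp: left_hom_def hom_def)

context left_module
begin

lemma smult_l_null: "x \<in> carrier M \<Longrightarrow> \<zero> \<odot>\<^bsub>M\<^esub> x = \<zero>\<^bsub>M\<^esub>"
  by (metis M.add.l_cancel_one' R.l_zero R.zero_closed smult_closed smult_l_distr)

lemma smult_r_null: "a \<in> carrier R \<Longrightarrow> a \<odot>\<^bsub>M\<^esub> \<zero>\<^bsub>M\<^esub> = \<zero>\<^bsub>M\<^esub>"
  by (metis M.add.l_cancel_one' M.l_zero M.zero_closed smult_closed smult_r_distr)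

lemma finsum_smult_l:
  assumes "x \<in> carrier M" "c \<in> I \<rightarrow> carrier R"
  shows "(\<Oplus>i\<in>I. c i) \<odot>\<^bsub>M\<^esub> x = (\<Oplus>\<^bsub>M\<^esub>i\<in>I. c i \<odot>\<^bsub>M\<^esub> x)"
  by (rule additive_finsum)
    (use assms in \<open>auto simp: hom_def smult_closed smult_l_distr R.is_abelian_group M.abelian_group_axioms\<close>)

lemma finsum_smult_r:
  assumes "a \<in> carrier R" "g \<in> I \<rightarrow> carrier M"
  shows "a \<odot>\<^bsub>M\<^esub> (\<Oplus>\<^bsub>M\<^esub>i\<in>I. g i) = (\<Oplus>\<^bsub>M\<^esub>i\<in>I. a \<odot>\<^bsub>M\<^esub> g i)"
  by (rule additive_finsum)
    (use assms in \<open>auto simp: hom_def smult_closed smult_r_distr M.abelian_group_axioms\<close>)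

end

lemma left_moduleI:
  assumes "ring R" "abelian_group M"
    and "\<And>a x. \<lbrakk>a \<in> carrier R; x \<in> carrier M\<rbrakk> \<Longrightarrow> a \<odot>\<^bsub>M\<^esub> x \<in> carrier M"
    and "\<And>a b x. \<lbrakk>a \<in> carrier R; b \<in> carrier R; x \<in> carrier M\<rbrakk> \<Longrightarrow>
        (a \<oplus>\<^bsub>R\<^esub> b) \<odot>\<^bsub>M\<^esub> x = a \<odot>\<^bsub>M\<^esub> x \<oplus>\<^bsub>M\<^esub> b \<odot>\<^bsub>M\<^esub> x"
    and "\<And>a x y. \<lbrakk>a \<in> carrier R; x \<in> carrier M; y \<in> carrier M\<rbrakk> \<Longrightarrow>
        a \<odot>\<^bsub>M\<^esub> (x \<oplus>\<^bsub>M\<^esub> y) = a \<odot>\<^bsub>M\<^esub> x \<oplus>\<^bsub>M\<^esub> a \<odot>\<^bsub>M\<^esub> y"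
    and "\<And>a b x. \<lbrakk>a \<in> carrier R; b \<in> carrier R; x \<in> carrier M\<rbrakk> \<Longrightarrow>
        (a \<otimes>\<^bsub>R\<^esub> b) \<odot>\<^bsub>M\<^esub> x = a \<odot>\<^bsub>M\<^esub> (b \<odot>\<^bsub>M\<^esub> x)"
    and "\<And>x. x \<in> carrier M \<Longrightarrow> \<one>\<^bsub>R\<^esub> \<odot>\<^bsub>M\<^esub> x = x"
  shows "left_module R M"
  using assms by (simp add: left_module_def left_module_axioms_def)

section \<open>Regular modules, restriction of scalars, left ideals and finite powers\<close>

lemma left_module_regular:
  assumes "ring A"
  shows "left_module A (regular_bimodule A)"
proof -
  interpret ring A by fact
  have "abelian_group (regular_bimodule A)"
    by (rule abelian_group_restrict_carrier[OF is_abelian_group])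
      (use add.subgroup_self in \<open>auto simp: regular_bimodule_def\<close>)
  then show ?thesis
    by (intro left_moduleI assms) (auto simp: regular_bimodule_def m_assoc l_distr r_distr)
qed

lemma left_module_restrict_scalars:
  assumes "ring_hom_ring R A \<iota>" "left_module A M"
  shows "left_module R (restrict_scalars \<iota> M)"
proof -
  interpret ring_hom_ring R A \<iota> by fact
  interpret M: left_module A M by fact
  have "abelian_group (restrict_scalars \<iota> M)"
    by (rule abelian_group_restrict_carrier[OF M.M.abelian_group_axioms])
      (use M.M.add.subgroup_self in \<open>auto simp: restrict_scalars_def\<close>)
  then show ?thesis
    by (intro left_moduleI R.ring_axioms)
      (auto simp: restrict_scalars_def M.smult_closed M.smult_l_distr M.smult_r_distr M.smult_assoc M.smult_one)
qed

lemma left_module_left_ideal: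
  assumes "ring A" "e \<in> carrier A"
  shows "left_module A (left_ideal_module A e)"
proof -
  interpret ring A by fact
  have "subgroup (carrier (left_ideal_module A e)) (add_monoid A)"
    by (rule add.subgroupI)
      (use assms(2) in \<open>auto simp: left_ideal_module_def image_iff l_minus[symmetric] l_distr[symmetric] simp flip: a_inv_def\<close>)
  then have "abelian_group (left_ideal_module A e)"
    by (rule abelian_group_restrict_carrier[OF is_abelian_group]) (auto simp: left_ideal_module_def)
  then show ?thesis
    by (intro left_moduleI assms)
      (use assms(2) in \<open>auto simp: left_ideal_module_def image_iff m_assoc l_distr r_distr simp flip: m_assoc\<close>)
qed

lemma left_module_power:
  assumes "left_module R M"
  shows "left_module R (module_power M n)"
proof -
  interpret left_module R M by fact
  have "abelian_group (module_power M n)"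
  proof (rule abelian_groupI)
    fix x assume x: "x \<in> carrier (module_power M n)"
    show "\<exists>y\<in>carrier (module_power M n). y \<oplus>\<^bsub>module_power M n\<^esub> x = \<zero>\<^bsub>module_power M n\<^esub>"
      using x by (intro bexI[of _ "\<lambda>i\<in>{..<n}. \<ominus>\<^bsub>M\<^esub> x i"])
        (auto simp: module_power_def M.l_neg fun_eq_iff PiE_iff)
  qed (auto simp: module_power_def PiE_def M.a_ac fun_eq_iff extensional_def Pi_def)
  then show ?thesis
    by (intro left_moduleI R.ring_axioms)
      (auto simp: module_power_def PiE_def extensional_def fun_eq_iff Pi_def smult_closed
         smult_l_distr smult_r_distr smult_assoc smult_one)
qed


section \<open>Dual bases\<close>

text \<open>The family \<open>v\<close> may take a value several times, while
  \<open>finitely_generated\<close> allows one coefficient per generator. The coefficient of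
  \<open>g\<close> is therefore the sum of the \<open>u j x\<close> over the fibre of
  \<open>v\<close> above \<open>g\<close>.\<close>

lemma (in left_module) finitely_generated_of_dual_basis:
  assumes "finite I" "v \<in> I \<rightarrow> carrier M"
    and u: "\<And>j x. j \<in> I \<Longrightarrow> x \<in> carrier M \<Longrightarrow> u j x \<in> carrier R"
    and dual: "\<And>x. x \<in> carrier M \<Longrightarrow> (\<Oplus>\<^bsub>M\<^esub>j\<in>I. u j x \<odot>\<^bsub>M\<^esub> v j) = x"
  shows "finitely_generated R M"
  unfolding finitely_generated_def
proof (intro exI[of _ "v ` I"] conjI ballI)
  show "finite (v ` I)" "v ` I \<subseteq> carrier M"
    using assms by auto
  fix x assume x: "x \<in> carrier M"
  define J where "J g = {j \<in> I. v j = g}" for g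
  define c where "c g = (\<Oplus>j\<in>J g. u j x)" for g
  have UN: "(\<Union>g\<in>v ` I. J g) = I"
    by (auto simp: J_def)
  have term_closed: "u j x \<odot>\<^bsub>M\<^esub> v j \<in> carrier M" if "j \<in> I" for j
    using that assms(2) u x smult_closed by blast
  have "c g \<odot>\<^bsub>M\<^esub> g = (\<Oplus>\<^bsub>M\<^esub>j\<in>J g. u j x \<odot>\<^bsub>M\<^esub> v j)" if "g \<in> v ` I" for g
  proof -
    have "c g \<odot>\<^bsub>M\<^esub> g = (\<Oplus>\<^bsub>M\<^esub>j\<in>J g. u j x \<odot>\<^bsub>M\<^esub> g)"
      unfolding c_def using that assms(2) u x by (intro finsum_smult_l) (auto simp: J_def)
    also have "\<dots> = (\<Oplus>\<^bsub>M\<^esub>j\<in>J g. u j x \<odot>\<^bsub>M\<^esub> v j)"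
      using term_closed by (intro M.finsum_cong') (auto simp: J_def)
    finally show ?thesis .
  qed
  moreover have "(\<Oplus>\<^bsub>M\<^esub>j\<in>J g. u j x \<odot>\<^bsub>M\<^esub> v j) \<in> carrier M" for g
    using term_closed by (intro M.finsum_closed) (auto simp: J_def)
  ultimately have "(\<Oplus>\<^bsub>M\<^esub>g\<in>v ` I. c g \<odot>\<^bsub>M\<^esub> g) = (\<Oplus>\<^bsub>M\<^esub>g\<in>v ` I. \<Oplus>\<^bsub>M\<^esub>j\<in>J g. u j x \<odot>\<^bsub>M\<^esub> v j)"
    by (intro M.finsum_cong') auto
  \<comment> \<open>The fibres \<open>J g\<close> partition \<open>I\<close>, so the double sum is
    the dual basis expansion of \<open>x\<close>.\<close>
  also have "\<dots> = (\<Oplus>\<^bsub>M\<^esub>j\<in>(\<Union>g\<in>v ` I. J g). u j x \<odot>\<^bsub>M\<^esub> v j)"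
    using assms(1) term_closed
    by (intro M.add.finprod_UN_disjoint[symmetric]) (auto simp: J_def pairwise_def disjnt_def)
  also have "\<dots> = x"
    using dual[OF x] UN by simp
  finally have "x = (\<Oplus>\<^bsub>M\<^esub>g\<in>v ` I. c g \<odot>\<^bsub>M\<^esub> g)" ..
  moreover have "c \<in> v ` I \<rightarrow> carrier R"
    unfolding c_def using u x by (auto intro!: R.finsum_closed simp: J_def)
  ultimately show "\<exists>c\<in>v ` I \<rightarrow> carrier R. x = (\<Oplus>\<^bsub>M\<^esub>g\<in>v ` I. c g \<odot>\<^bsub>M\<^esub> g)" by blast
qed

text \<open>A lift only has to be chosen on the \<open>v j\<close>: pick \<open>y j\<close> over
  \<open>f (v j)\<close> and let \<open>h x\<close> be the sum of the \<open>u j x\<close> times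
  \<open>y j\<close>. Linearity of the \<open>u j\<close> makes \<open>h\<close> linear, and the
  expansion of \<open>x\<close> gives \<open>p (h x) = f x\<close>.\<close>

lemma (in left_module) projective_of_dual_basis:
  assumes "v \<in> I \<rightarrow> carrier M"
    and u: "\<And>j. j \<in> I \<Longrightarrow> u j \<in> left_hom R M (regular_bimodule R)"
    and dual: "\<And>x. x \<in> carrier M \<Longrightarrow> (\<Oplus>\<^bsub>M\<^esub>j\<in>I. u j x \<odot>\<^bsub>M\<^esub> v j) = x"
  shows "projective R M"
  unfolding projective_def
proof (intro allI impI, elim conjE)
  fix N :: "('r, 'm \<Rightarrow> 'r) module" and P :: "('r, 'm) module" and p f
  assume N: "left_module R N" and P: "left_module R P"
    and p: "p \<in> left_hom R N P" and surj: "p ` carrier N = carrier P"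
    and f: "f \<in> left_hom R M P"
  interpret N: left_module R N by fact
  interpret P: left_module R P by fact
  have "\<forall>j\<in>I. \<exists>y\<in>carrier N. p y = f (v j)"
    using surj left_hom_closed[OF f] assms(1) by (metis Pi_mem imageE)
  then obtain y where y: "\<And>j. j \<in> I \<Longrightarrow> y j \<in> carrier N" "\<And>j. j \<in> I \<Longrightarrow> p (y j) = f (v j)"
    by metis
  have ucl: "u j x \<in> carrier R" if "j \<in> I" "x \<in> carrier M" for j x
    using left_hom_closed[OF u] that by (simp add: regular_bimodule_def)
  have uadd: "u j (x \<oplus>\<^bsub>M\<^esub> x') = u j x \<oplus> u j x'" if "j \<in> I" "x \<in> carrier M" "x' \<in> carrier M" for j x x'
    using left_hom_add[OF u] that by (simp add: regular_bimodule_def)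
  have usmult: "u j (a \<odot>\<^bsub>M\<^esub> x) = a \<otimes> u j x" if "j \<in> I" "a \<in> carrier R" "x \<in> carrier M" for j a x
    using left_hom_smult[OF u] that by (simp add: regular_bimodule_def)
  define h where "h x = (\<Oplus>\<^bsub>N\<^esub>j\<in>I. u j x \<odot>\<^bsub>N\<^esub> y j)" for x
  have hcl: "(\<lambda>j. u j x \<odot>\<^bsub>N\<^esub> y j) \<in> I \<rightarrow> carrier N" if "x \<in> carrier M" for x
    using ucl y that N.smult_closed by auto
  have "h \<in> left_hom R M N"
  proof (rule left_homI)
    fix x x' assume xx': "x \<in> carrier M" "x' \<in> carrier M"
    have "h (x \<oplus>\<^bsub>M\<^esub> x') = (\<Oplus>\<^bsub>N\<^esub>j\<in>I. u j x \<odot>\<^bsub>N\<^esub> y j \<oplus>\<^bsub>N\<^esub> u j x' \<odot>\<^bsub>N\<^esub> y j)"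
      unfolding h_def using xx' ucl y hcl[OF xx'(1)] hcl[OF xx'(2)]
      by (intro N.finsum_cong') (auto simp: uadd N.smult_l_distr)
    then show "h (x \<oplus>\<^bsub>M\<^esub> x') = h x \<oplus>\<^bsub>N\<^esub> h x'"
      unfolding h_def using hcl xx' by (simp add: N.finsum_addf)
  next
    fix a x assume ax: "a \<in> carrier R" "x \<in> carrier M"
    have "h (a \<odot>\<^bsub>M\<^esub> x) = (\<Oplus>\<^bsub>N\<^esub>j\<in>I. a \<odot>\<^bsub>N\<^esub> (u j x \<odot>\<^bsub>N\<^esub> y j))"
      unfolding h_def using ax ucl y hcl[OF ax(2)]
      by (intro N.finsum_cong') (auto simp: usmult N.smult_assoc N.smult_closed)
    then show "h (a \<odot>\<^bsub>M\<^esub> x) = a \<odot>\<^bsub>N\<^esub> h x"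
      unfolding h_def using N.finsum_smult_r[OF ax(1) hcl[OF ax(2)]] by simp
  qed (use hcl in \<open>auto simp: h_def\<close>)
  moreover have "p (h x) = f x" if x: "x \<in> carrier M" for x
  proof -
    have fcl: "u j x \<odot>\<^bsub>M\<^esub> v j \<in> carrier M" if "j \<in> I" for j
      using that assms(1) ucl x smult_closed by blast
    have "p (h x) = (\<Oplus>\<^bsub>P\<^esub>j\<in>I. p (u j x \<odot>\<^bsub>N\<^esub> y j))"
      unfolding h_def
      by (rule additive_finsum[OF N.M.abelian_group_axioms P.M.abelian_group_axioms left_hom_additive[OF p] hcl[OF x]])
    \<comment> \<open>Both summands equal \<open>u j x\<close> times \<open>f (v j)\<close>, by
      linearity of \<open>p\<close> and of \<open>f\<close>.\<close>
    also have "\<dots> = (\<Oplus>\<^bsub>P\<^esub>j\<in>I. f (u j x \<odot>\<^bsub>M\<^esub> v j))"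
      using ucl[OF _ x] y assms(1) left_hom_smult[OF p] left_hom_smult[OF f] left_hom_closed[OF f] P.smult_closed fcl
      by (intro P.finsum_cong') (auto simp: Pi_def)
    also have "\<dots> = f (\<Oplus>\<^bsub>M\<^esub>j\<in>I. u j x \<odot>\<^bsub>M\<^esub> v j)"
      by (rule additive_finsum[symmetric, OF M.abelian_group_axioms P.M.abelian_group_axioms left_hom_additive[OF f]])
        (use fcl in auto)
    finally show ?thesis using dual[OF x] by simp
  qed
  ultimately show "\<exists>h\<in>left_hom R M N. \<forall>x\<in>carrier M. p (h x) = f x" by blast
qed

section \<open>Summands of finite powers\<close>

text \<open>The sum being direct, the component in \<open>K\<close> is well defined and hence
  linear. This trades the complement in the definition for a retraction, which is easier to compose
  with other maps.\<close>

lemma left_direct_summand_projection: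
  assumes "left_module R P" "left_direct_summand K R P"
  obtains \<pi> where "\<pi> \<in> left_hom R P (P\<lparr>carrier := K\<rparr>)" "\<And>x. x \<in> K \<Longrightarrow> \<pi> x = x"
proof -
  interpret left_module R P by fact
  obtain L where K: "submodule K R P" and L: "submodule L R P"
    and sum: "K <+>\<^bsub>P\<^esub> L = carrier P" and int: "K \<inter> L = {\<zero>\<^bsub>P\<^esub>}"
    using assms(2) unfolding left_direct_summand_def by blast
  interpret K: submodule K R P by fact
  interpret L: submodule L R P by fact
  have Kc: "k \<in> K \<Longrightarrow> k \<in> carrier P" and Lc: "l \<in> L \<Longrightarrow> l \<in> carrier P" for k l
    using K.subset L.subset by auto
  \<comment> \<open>The element \<open>k - k' = l' - l\<close> lies in both \<open>K\<close> and
    \<open>L\<close>, hence is zero.\<close>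
  have uniq: "k = k'" if "k \<in> K" "k' \<in> K" "l \<in> L" "l' \<in> L" "k \<oplus>\<^bsub>P\<^esub> l = k' \<oplus>\<^bsub>P\<^esub> l'" for k k' l l'
  proof -
    note c = Kc[OF that(1)] Kc[OF that(2)] Lc[OF that(3)] Lc[OF that(4)]
    have "k \<ominus>\<^bsub>P\<^esub> k' = (k \<oplus>\<^bsub>P\<^esub> l) \<oplus>\<^bsub>P\<^esub> (\<ominus>\<^bsub>P\<^esub> l \<oplus>\<^bsub>P\<^esub> \<ominus>\<^bsub>P\<^esub> k')"
      using c by (simp add: M.minus_eq M.a_assoc M.r_neg2)
    also have "\<dots> = (l' \<oplus>\<^bsub>P\<^esub> k') \<oplus>\<^bsub>P\<^esub> (\<ominus>\<^bsub>P\<^esub> k' \<oplus>\<^bsub>P\<^esub> \<ominus>\<^bsub>P\<^esub> l)"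
      unfolding that(5) using c by (simp add: M.a_comm)
    also have "\<dots> = l' \<ominus>\<^bsub>P\<^esub> l"
      using c by (simp add: M.minus_eq M.a_assoc M.r_neg2)
    finally have "k \<ominus>\<^bsub>P\<^esub> k' = l' \<ominus>\<^bsub>P\<^esub> l" .
    moreover have "k \<ominus>\<^bsub>P\<^esub> k' \<in> K"
      using that K.m_closed K.m_inv_closed by (simp add: a_minus_def a_inv_def)
    moreover have "l' \<ominus>\<^bsub>P\<^esub> l \<in> L"
      using that L.m_closed L.m_inv_closed by (simp add: a_minus_def a_inv_def)
    ultimately have "k \<ominus>\<^bsub>P\<^esub> k' = \<zero>\<^bsub>P\<^esub>"
      using int by auto
    then show "k = k'"
      using c M.minus_equality[of k "\<ominus>\<^bsub>P\<^esub> k'"] by (simp add: M.minus_eq)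
  qed
  have "\<forall>x\<in>carrier P. \<exists>k l. k \<in> K \<and> l \<in> L \<and> x = k \<oplus>\<^bsub>P\<^esub> l"
  proof -
    have "carrier P = (\<Union>k\<in>K. \<Union>l\<in>L. {k \<oplus>\<^bsub>P\<^esub> l})"
      using sum by (simp add: set_add_def set_mult_def)
    then show ?thesis by blast
  qed
  then obtain \<pi> \<rho> where dec: "\<And>x. x \<in> carrier P \<Longrightarrow> \<pi> x \<in> K"
    "\<And>x. x \<in> carrier P \<Longrightarrow> \<rho> x \<in> L" "\<And>x. x \<in> carrier P \<Longrightarrow> x = \<pi> x \<oplus>\<^bsub>P\<^esub> \<rho> x"
    by metis
  \<comment> \<open>The components \<open>\<pi>\<close> and \<open>\<rho>\<close> were merely
    chosen. By uniqueness any decomposition of \<open>x\<close> computes \<open>\<pi> x\<close>, so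
    linearity follows by adding or scaling decompositions.\<close>
  have \<pi>I: "\<pi> x = k" if "k \<in> K" "l \<in> L" "x = k \<oplus>\<^bsub>P\<^esub> l" for x k l
  proof -
    have x: "x \<in> carrier P"
      using that Kc Lc by simp
    show ?thesis
      using uniq[OF dec(1)[OF x] that(1) dec(2)[OF x] that(2)] dec(3)[OF x] that(3) by metis
  qed
  have "\<pi> \<in> left_hom R P (P\<lparr>carrier := K\<rparr>)"
  proof (rule left_homI)
    fix x y assume xy: "x \<in> carrier P" "y \<in> carrier P"
    have "\<pi> (x \<oplus>\<^bsub>P\<^esub> y) = \<pi> x \<oplus>\<^bsub>P\<^esub> \<pi> y"
    proof (rule \<pi>I)
      show "\<pi> x \<oplus>\<^bsub>P\<^esub> \<pi> y \<in> K" "\<rho> x \<oplus>\<^bsub>P\<^esub> \<rho> y \<in> L"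
        using dec(1,2) xy K.m_closed L.m_closed by auto
      have "x \<oplus>\<^bsub>P\<^esub> y = (\<pi> x \<oplus>\<^bsub>P\<^esub> \<rho> x) \<oplus>\<^bsub>P\<^esub> (\<pi> y \<oplus>\<^bsub>P\<^esub> \<rho> y)"
        by (rule arg_cong2[where f = "add P"]) (rule dec(3)[OF xy(1)] dec(3)[OF xy(2)])+
      also have "\<dots> = \<pi> x \<oplus>\<^bsub>P\<^esub> \<pi> y \<oplus>\<^bsub>P\<^esub> (\<rho> x \<oplus>\<^bsub>P\<^esub> \<rho> y)"
        using dec(1,2) xy Kc Lc by (simp add: M.a_assoc M.a_lcomm)
      finally show "x \<oplus>\<^bsub>P\<^esub> y = \<pi> x \<oplus>\<^bsub>P\<^esub> \<pi> y \<oplus>\<^bsub>P\<^esub> (\<rho> x \<oplus>\<^bsub>P\<^esub> \<rho> y)" .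
    qed
    then show "\<pi> (x \<oplus>\<^bsub>P\<^esub> y) = \<pi> x \<oplus>\<^bsub>P\<lparr>carrier := K\<rparr>\<^esub> \<pi> y" by simp
  next
    fix a x assume ax: "a \<in> carrier R" "x \<in> carrier P"
    have "\<pi> (a \<odot>\<^bsub>P\<^esub> x) = a \<odot>\<^bsub>P\<^esub> \<pi> x"
    proof (rule \<pi>I)
      show "a \<odot>\<^bsub>P\<^esub> \<pi> x \<in> K" "a \<odot>\<^bsub>P\<^esub> \<rho> x \<in> L"
        using dec(1,2) ax K.smult_closed L.smult_closed by auto
      show "a \<odot>\<^bsub>P\<^esub> x = a \<odot>\<^bsub>P\<^esub> \<pi> x \<oplus>\<^bsub>P\<^esub> a \<odot>\<^bsub>P\<^esub> \<rho> x"
        using dec ax Kc Lc smult_r_distr by metis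
    qed
    then show "\<pi> (a \<odot>\<^bsub>P\<^esub> x) = a \<odot>\<^bsub>P\<lparr>carrier := K\<rparr>\<^esub> \<pi> x" by simp
  qed (use dec(1) in auto)
  moreover have "\<pi> x = x" if "x \<in> K" for x
    using that Kc L.one_closed by (intro \<pi>I[of _ "\<zero>\<^bsub>P\<^esub>"]) auto
  ultimately show thesis using that by blast
qed

text \<open>Tuples are extensional functions, so it suffices to compare coordinates. Evaluation at
  \<open>i\<close> is additive, and only the summand \<open>j = i\<close> survives it.\<close>

lemma module_power_decompose:
  assumes "left_module R M" "z \<in> carrier (module_power M n)"
  shows "(\<Oplus>\<^bsub>module_power M n\<^esub>j\<in>{..<n}. (\<lambda>i\<in>{..<n}. if i = j then z j else \<zero>\<^bsub>M\<^esub>)) = z"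
    (is "?s = z")
proof (rule extensionalityI)
  interpret left_module R M by fact
  interpret P: left_module R "module_power M n"
    using left_module_power[OF assms(1)] .
  let ?e = "\<lambda>j. \<lambda>i\<in>{..<n}. if i = j then z j else \<zero>\<^bsub>M\<^esub>"
  have ecl: "?e \<in> {..<n} \<rightarrow> carrier (module_power M n)"
    using assms(2) by (auto simp: module_power_def PiE_iff)
  have "?s \<in> carrier (module_power M n)"
    using ecl by (rule P.finsum_closed)
  then show "?s \<in> extensional {..<n}" "z \<in> extensional {..<n}"
    using assms(2) by (auto simp: module_power_def PiE_iff)
  fix i assume i: "i \<in> {..<n}"
  have "?s i = (\<Oplus>\<^bsub>M\<^esub>j\<in>{..<n}. ?e j i)"
    by (rule additive_finsum[where f = "\<lambda>x. x i"])
      (use i ecl P.M.abelian_group_axioms M.abelian_group_axioms in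
        \<open>auto simp: hom_def module_power_def PiE_iff\<close>)
  also have "\<dots> = (\<Oplus>\<^bsub>M\<^esub>j\<in>{..<n}. if i = j then z j else \<zero>\<^bsub>M\<^esub>)"
    using i assms(2) by (intro M.finsum_cong') (auto simp: module_power_def PiE_iff)
  also have "\<dots> = z i"
    using i assms(2) by (intro M.finsum_singleton) (auto simp: module_power_def PiE_iff)
  finally show "?s i = z i" .
qed

text \<open>Let \<open>f\<close> embed \<open>N\<close> as a summand \<open>K\<close> of the power.
  Then \<open>u j\<close> is \<open>f\<close> followed by the \<open>j\<close>-th projection, and
  \<open>w j\<close> is the \<open>j\<close>-th inclusion followed by the retraction onto
  \<open>K\<close> and the inverse of \<open>f\<close>. The sum of the composites is the identity
  because the retraction fixes \<open>K\<close>.\<close>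

lemma in_add_coordinates:
  assumes M: "left_module R M" and N: "left_module R N" and "in_add R M N"
  obtains n u w where "\<And>j. j < n \<Longrightarrow> u j \<in> left_hom R N M" "\<And>j. j < n \<Longrightarrow> w j \<in> left_hom R M N"
    "\<And>x. x \<in> carrier N \<Longrightarrow> (\<Oplus>\<^bsub>N\<^esub>j\<in>{..<n::nat}. w j (u j x)) = x"
proof -
  interpret M: left_module R M by fact
  interpret N: left_module R N by fact
  obtain n K f where sum: "left_direct_summand K R (module_power M n)"
    and f: "f \<in> left_hom R N ((module_power M n)\<lparr>carrier := K\<rparr>)" and bij: "bij_betw f (carrier N) K"
    using assms(3) unfolding in_add_def left_isomorphic_def by auto
  define P where "P = module_power M n"
  interpret P: left_module R P
    unfolding P_def using left_module_power[OF M] .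
  obtain \<pi> where \<pi>: "\<pi> \<in> left_hom R P (P\<lparr>carrier := K\<rparr>)" "\<And>x. x \<in> K \<Longrightarrow> \<pi> x = x"
    using left_direct_summand_projection[OF P.left_module_axioms] sum unfolding P_def by blast
  define g where "g = inv_into (carrier N) f"
  have g: "g k \<in> carrier N" "f (g k) = k" if "k \<in> K" for k
    using that bij by (auto simp: g_def bij_betw_def inv_into_into f_inv_into_f)
  have gf: "g (f x) = x" if "x \<in> carrier N" for x
    using that bij by (simp add: g_def bij_betw_def)
  have KP: "K \<subseteq> carrier P"
    using sum unfolding left_direct_summand_def P_def submodule_def subgroup_def by auto
  \<comment> \<open>A left inverse of \<open>f\<close> defined on the whole power.\<close>
  define \<beta> where "\<beta> z = g (\<pi> z)" for z
  have \<beta>: "\<beta> \<in> left_hom R P N"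
  proof (rule left_homI)
    fix x assume x: "x \<in> carrier P"
    then show "\<beta> x \<in> carrier N"
      using left_hom_closed[OF \<pi>(1) x] g by (simp add: \<beta>_def)
    fix y assume y: "y \<in> carrier P"
    \<comment> \<open>Additivity of \<open>\<beta>\<close> is checked after applying
      \<open>f\<close>, where it becomes additivity of \<open>\<pi>\<close>; applying
      \<open>g\<close> returns to \<open>N\<close>. Scalars are treated in the same way.\<close>
    have "f (\<beta> x \<oplus>\<^bsub>N\<^esub> \<beta> y) = \<pi> (x \<oplus>\<^bsub>P\<^esub> y)"
      using left_hom_closed[OF \<pi>(1) x] left_hom_closed[OF \<pi>(1) y] x y left_hom_add[OF \<pi>(1) x y] g
        left_hom_add[OF f, of "\<beta> x" "\<beta> y"] by (simp add: \<beta>_def P_def)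
    then show "\<beta> (x \<oplus>\<^bsub>P\<^esub> y) = \<beta> x \<oplus>\<^bsub>N\<^esub> \<beta> y"
      using gf[of "\<beta> x \<oplus>\<^bsub>N\<^esub> \<beta> y"] g left_hom_closed[OF \<pi>(1) x] left_hom_closed[OF \<pi>(1) y]
      by (simp add: \<beta>_def)
  next
    fix a x assume ax: "a \<in> carrier R" "x \<in> carrier P"
    have "f (a \<odot>\<^bsub>N\<^esub> \<beta> x) = \<pi> (a \<odot>\<^bsub>P\<^esub> x)"
      using left_hom_closed[OF \<pi>(1) ax(2)] ax left_hom_smult[OF \<pi>(1) ax] g
        left_hom_smult[OF f, of a "\<beta> x"] by (simp add: \<beta>_def P_def)
    then show "\<beta> (a \<odot>\<^bsub>P\<^esub> x) = a \<odot>\<^bsub>N\<^esub> \<beta> x"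
      using gf[of "a \<odot>\<^bsub>N\<^esub> \<beta> x"] g left_hom_closed[OF \<pi>(1) ax(2)] ax N.smult_closed
      by (simp add: \<beta>_def)
  qed
  define u where "u j x = f x j" for j x
  define w where "w j a = \<beta> (\<lambda>i\<in>{..<n}. if i = j then a else \<zero>\<^bsub>M\<^esub>)" for j a
  have fP: "f x \<in> carrier P" "f x \<in> K" if "x \<in> carrier N" for x
    using left_hom_closed[OF f that] KP by auto
  have "u j \<in> left_hom R N M" if "j < n" for j
    using that fP(1) left_hom_add[OF f] left_hom_smult[OF f]
    by (intro left_homI) (auto simp: u_def P_def module_power_def PiE_iff)
  moreover have "w j \<in> left_hom R M N" if j: "j < n" for j
  proof (rule left_homI)
    let ?e = "\<lambda>a. \<lambda>i\<in>{..<n}. if i = j then a else \<zero>\<^bsub>M\<^esub>"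
    have e: "?e a \<in> carrier P" if "a \<in> carrier M" for a
      using that by (auto simp: P_def module_power_def PiE_iff)
    fix a assume a: "a \<in> carrier M"
    then show "w j a \<in> carrier N"
      using left_hom_closed[OF \<beta> e] by (simp add: w_def)
    fix b assume b: "b \<in> carrier M"
    have "?e (a \<oplus>\<^bsub>M\<^esub> b) = ?e a \<oplus>\<^bsub>P\<^esub> ?e b"
      using a b by (auto simp: P_def module_power_def fun_eq_iff)
    then show "w j (a \<oplus>\<^bsub>M\<^esub> b) = w j a \<oplus>\<^bsub>N\<^esub> w j b"
      using left_hom_add[OF \<beta> e[OF a] e[OF b]] by (simp add: w_def)
  next
    let ?e = "\<lambda>a. \<lambda>i\<in>{..<n}. if i = j then a else \<zero>\<^bsub>M\<^esub>"
    fix r a assume r: "r \<in> carrier R" and a: "a \<in> carrier M"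
    have e: "?e a \<in> carrier P"
      using a by (auto simp: P_def module_power_def PiE_iff)
    have "?e (r \<odot>\<^bsub>M\<^esub> a) = r \<odot>\<^bsub>P\<^esub> ?e a"
      using r a by (auto simp: P_def module_power_def fun_eq_iff M.smult_r_null)
    then show "w j (r \<odot>\<^bsub>M\<^esub> a) = r \<odot>\<^bsub>N\<^esub> w j a"
      using left_hom_smult[OF \<beta> r e] by (simp add: w_def)
  qed
  moreover have "(\<Oplus>\<^bsub>N\<^esub>j\<in>{..<n}. w j (u j x)) = x" if x: "x \<in> carrier N" for x
  proof -
    have "x = \<beta> (f x)"
      using gf[OF x] \<pi>(2)[OF fP(2)[OF x]] by (simp add: \<beta>_def)
    also have "\<dots> = \<beta> (\<Oplus>\<^bsub>P\<^esub>j\<in>{..<n}. (\<lambda>i\<in>{..<n}. if i = j then f x j else \<zero>\<^bsub>M\<^esub>))"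
      using module_power_decompose[OF M] fP(1)[OF x] unfolding P_def by simp
    also have "\<dots> = (\<Oplus>\<^bsub>N\<^esub>j\<in>{..<n}. \<beta> (\<lambda>i\<in>{..<n}. if i = j then f x j else \<zero>\<^bsub>M\<^esub>))"
      by (rule additive_finsum[OF P.M.abelian_group_axioms N.M.abelian_group_axioms left_hom_additive[OF \<beta>]])
        (use fP(1)[OF x] in \<open>auto simp: P_def module_power_def PiE_iff\<close>)
    finally show ?thesis
      by (simp add: w_def u_def)
  qed
  ultimately show thesis using that by blast
qed


section \<open>Frobenius forms\<close>

lemma left_hom_restrict_regular_iff:
  "f \<in> left_hom R (restrict_scalars \<iota> (regular_bimodule A)) (regular_bimodule R) \<longleftrightarrow>
    (\<forall>x\<in>carrier A. f x \<in> carrier R) \<and>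
    (\<forall>x\<in>carrier A. \<forall>y\<in>carrier A. f (x \<oplus>\<^bsub>A\<^esub> y) = f x \<oplus>\<^bsub>R\<^esub> f y) \<and>
    (\<forall>r\<in>carrier R. \<forall>x\<in>carrier A. f (\<iota> r \<otimes>\<^bsub>A\<^esub> x) = r \<otimes>\<^bsub>R\<^esub> f x)"
  by (auto simp: left_hom_def hom_def restrict_scalars_def regular_bimodule_def)

text \<open>Translates the isomorphism out of the nested records. Since \<open>left_hom\<close>
  reads only the carrier, the addition and the left action, the source of the linear maps may be
  replaced by the plain module \<open>restrict_scalars \<iota> (regular_bimodule A)\<close>.\<close>

lemma frobenius_isomorphic_iff:
  "bimodule_isomorphic A R (restrict_biscalars id \<iota> (regular_bimodule A))
      (Hom_bimodule R (restrict_biscalars \<iota> id (regular_bimodule A)) (regular_bimodule R)) \<longleftrightarrow>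
    (\<exists>\<Phi>. bij_betw \<Phi> (carrier A)
        (left_hom R (restrict_scalars \<iota> (regular_bimodule A)) (regular_bimodule R) \<inter> extensional (carrier A)) \<and>
      (\<forall>a\<in>carrier A. \<forall>b\<in>carrier A. \<Phi> (a \<oplus>\<^bsub>A\<^esub> b) = (\<lambda>x\<in>carrier A. \<Phi> a x \<oplus>\<^bsub>R\<^esub> \<Phi> b x)) \<and>
      (\<forall>a\<in>carrier A. \<forall>b\<in>carrier A. \<Phi> (a \<otimes>\<^bsub>A\<^esub> b) = (\<lambda>x\<in>carrier A. \<Phi> b (x \<otimes>\<^bsub>A\<^esub> a))) \<and>
      (\<forall>a\<in>carrier A. \<forall>r\<in>carrier R. \<Phi> (a \<otimes>\<^bsub>A\<^esub> \<iota> r) = (\<lambda>x\<in>carrier A. \<Phi> a x \<otimes>\<^bsub>R\<^esub> r)))"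
proof -
  have carrier: "carrier (restrict_biscalars f g (regular_bimodule A)) = carrier A"
    "carrier (Hom_bimodule R (restrict_biscalars \<iota> id (regular_bimodule A)) (regular_bimodule R)) =
      left_hom R (restrict_scalars \<iota> (regular_bimodule A)) (regular_bimodule R) \<inter> extensional (carrier A)"
    for f :: "'x \<Rightarrow> 'a" and g :: "'y \<Rightarrow> 'a"
    by (simp_all add: Hom_bimodule_def left_hom_def hom_def restrict_biscalars_def
        restrict_scalars_def regular_bimodule_def module.defs bimodule.defs)
  have left: "\<Phi> \<in> left_hom A (restrict_biscalars id \<iota> (regular_bimodule A))
        (Hom_bimodule R (restrict_biscalars \<iota> id (regular_bimodule A)) (regular_bimodule R)) \<longleftrightarrow>
      \<Phi> \<in> carrier A \<rightarrow> carrier (Hom_bimodule R (restrict_biscalars \<iota> id (regular_bimodule A)) (regular_bimodule R)) \<and>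
      (\<forall>a\<in>carrier A. \<forall>b\<in>carrier A. \<Phi> (a \<oplus>\<^bsub>A\<^esub> b) = (\<lambda>x\<in>carrier A. \<Phi> a x \<oplus>\<^bsub>R\<^esub> \<Phi> b x)) \<and>
      (\<forall>a\<in>carrier A. \<forall>b\<in>carrier A. \<Phi> (a \<otimes>\<^bsub>A\<^esub> b) = (\<lambda>x\<in>carrier A. \<Phi> b (x \<otimes>\<^bsub>A\<^esub> a)))" for \<Phi>
    by (simp add: left_hom_def hom_def restrict_biscalars_def restrict_scalars_def
        regular_bimodule_def module.defs bimodule.defs Hom_bimodule_def)
  have right: "x \<triangleleft>\<^bsub>restrict_biscalars id \<iota> (regular_bimodule A)\<^esub> r = x \<otimes>\<^bsub>A\<^esub> \<iota> r"
    "g \<triangleleft>\<^bsub>Hom_bimodule R (restrict_biscalars \<iota> id (regular_bimodule A)) (regular_bimodule R)\<^esub> r =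
      (\<lambda>x\<in>carrier A. g x \<otimes>\<^bsub>R\<^esub> r)" for x r g
    by (simp_all add: restrict_biscalars_def restrict_scalars_def
        regular_bimodule_def module.defs bimodule.defs Hom_bimodule_def)
  show ?thesis
    unfolding bimodule_isomorphic_def left right
    unfolding Bex_def left carrier
    by (rule iff_exI) (use bij_betw_imp_funcset in blast)
qed

text \<open>Nondegeneracy says that \<open>y\<close> is determined by the map \<open>E(- y)\<close>.
  Representability of all linear maps is kept apart: it is a second conclusion of
  \<open>frobenius_extensionE\<close>, and in \<open>frobenius_extensionI\<close> it is derived from
  dual bases.\<close>

locale frobenius_form = ring_hom_ring R A \<iota> for R (structure) and A (structure) and \<iota> +
  fixes E
  assumes form_closed: "x \<in> carrier A \<Longrightarrow> E x \<in> carrier R"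
    and form_add: "\<lbrakk>x \<in> carrier A; y \<in> carrier A\<rbrakk> \<Longrightarrow> E (x \<oplus>\<^bsub>A\<^esub> y) = E x \<oplus> E y"
    and form_left: "\<lbrakk>r \<in> carrier R; x \<in> carrier A\<rbrakk> \<Longrightarrow> E (\<iota> r \<otimes>\<^bsub>A\<^esub> x) = r \<otimes> E x"
    and form_right: "\<lbrakk>x \<in> carrier A; r \<in> carrier R\<rbrakk> \<Longrightarrow> E (x \<otimes>\<^bsub>A\<^esub> \<iota> r) = E x \<otimes> r"
    and nondegenerate: "\<lbrakk>y \<in> carrier A; \<And>x. x \<in> carrier A \<Longrightarrow> E (x \<otimes>\<^bsub>A\<^esub> y) = \<zero>\<rbrakk> \<Longrightarrow> y = \<zero>\<^bsub>A\<^esub>"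

text \<open>Injectivity of the isomorphism \<open>\<Phi>\<close> becomes nondegeneracy of the form,
  and its surjectivity becomes representability of linear maps.\<close>

lemma frobenius_extensionE:
  assumes "frobenius_extension R A \<iota>"
  obtains E where "frobenius_form R A \<iota> E"
    "\<And>f. f \<in> left_hom R (restrict_scalars \<iota> (regular_bimodule A)) (regular_bimodule R) \<Longrightarrow>
      \<exists>w\<in>carrier A. \<forall>x\<in>carrier A. f x = E (x \<otimes>\<^bsub>A\<^esub> w)"
proof -
  interpret ring_hom_ring R A \<iota>
    using assms by (simp add: frobenius_extension_def)
  let ?H = "left_hom R (restrict_scalars \<iota> (regular_bimodule A)) (regular_bimodule R) \<inter> extensional (carrier A)"
  obtain \<Phi> where bij: "bij_betw \<Phi> (carrier A) ?H"
    and add: "\<And>a b. a \<in> carrier A \<Longrightarrow> b \<in> carrier A \<Longrightarrow>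
      \<Phi> (a \<oplus>\<^bsub>A\<^esub> b) = (\<lambda>x\<in>carrier A. \<Phi> a x \<oplus>\<^bsub>R\<^esub> \<Phi> b x)"
    and left: "\<And>a b. a \<in> carrier A \<Longrightarrow> b \<in> carrier A \<Longrightarrow>
      \<Phi> (a \<otimes>\<^bsub>A\<^esub> b) = (\<lambda>x\<in>carrier A. \<Phi> b (x \<otimes>\<^bsub>A\<^esub> a))"
    and right: "\<And>a r. a \<in> carrier A \<Longrightarrow> r \<in> carrier R \<Longrightarrow>
      \<Phi> (a \<otimes>\<^bsub>A\<^esub> \<iota> r) = (\<lambda>x\<in>carrier A. \<Phi> a x \<otimes>\<^bsub>R\<^esub> r)"
    using assms unfolding frobenius_extension_def frobenius_isomorphic_iff by blast
  define E where "E = \<Phi> \<one>\<^bsub>A\<^esub>"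
  \<comment> \<open>Left \<open>A\<close>-linearity applied to \<open>a = a 1\<close>: the map
    \<open>\<Phi> a\<close> is \<open>a\<close> acting on \<open>\<Phi> 1 = E\<close>.\<close>
  have \<Phi>E: "\<Phi> a x = E (x \<otimes>\<^bsub>A\<^esub> a)" if "a \<in> carrier A" "x \<in> carrier A" for a x
    using left[OF that(1) S.one_closed] that by (simp add: E_def)
  have E: "E \<in> left_hom R (restrict_scalars \<iota> (regular_bimodule A)) (regular_bimodule R)"
    using bij by (auto simp: E_def bij_betw_def)
  have "frobenius_form R A \<iota> E"
  proof
    fix y assume y: "y \<in> carrier A" and zero: "\<And>x. x \<in> carrier A \<Longrightarrow> E (x \<otimes>\<^bsub>A\<^esub> y) = \<zero>\<^bsub>R\<^esub>"
    have "\<Phi> y \<in> extensional (carrier A)" "\<Phi> \<zero>\<^bsub>A\<^esub> \<in> extensional (carrier A)"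
      using bij y by (auto simp: bij_betw_def)
    \<comment> \<open>The hypothesis at \<open>x = 0\<close>. It lets \<open>\<Phi> y\<close> and
      \<open>\<Phi> 0\<close> agree on all of \<open>A\<close>.\<close>
    moreover have "E \<zero>\<^bsub>A\<^esub> = \<zero>\<^bsub>R\<^esub>"
      using zero[of "\<zero>\<^bsub>A\<^esub>"] y by simp
    ultimately have "\<Phi> y = \<Phi> \<zero>\<^bsub>A\<^esub>"
      using y zero by (intro extensionalityI[of _ "carrier A"]) (auto simp: \<Phi>E)
    then show "y = \<zero>\<^bsub>A\<^esub>"
      using bij y by (auto simp: bij_betw_def dest: inj_onD)
  next
    fix x r assume "x \<in> carrier A" "r \<in> carrier R"
    \<comment> \<open>The value of \<open>\<Phi> (\<iota> r)\<close> at \<open>x\<close> is computed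
      twice, through \<open>\<Phi>E\<close> and through right linearity at
      \<open>1 (\<iota> r)\<close>.\<close>
    then show "E (x \<otimes>\<^bsub>A\<^esub> \<iota> r) = E x \<otimes>\<^bsub>R\<^esub> r"
      using right[OF S.one_closed] \<Phi>E[of "\<iota> r" x] by (simp add: E_def)
  qed (use E in \<open>auto simp: left_hom_restrict_regular_iff\<close>)
  moreover have "\<exists>w\<in>carrier A. \<forall>x\<in>carrier A. f x = E (x \<otimes>\<^bsub>A\<^esub> w)"
    if "f \<in> left_hom R (restrict_scalars \<iota> (regular_bimodule A)) (regular_bimodule R)" for f
  proof -
    \<comment> \<open>The elements of the Hom bimodule are extensional, so \<open>f\<close> is first
      cut down to \<open>A\<close>.\<close>
    have "restrict f (carrier A) \<in> ?H"
      using that by (simp add: left_hom_restrict_regular_iff)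
    then obtain w where w: "w \<in> carrier A" "restrict f (carrier A) = \<Phi> w"
      using bij unfolding bij_betw_def by blast
    then have "f x = E (x \<otimes>\<^bsub>A\<^esub> w)" if "x \<in> carrier A" for x
      using \<Phi>E[OF w(1) that] w(2) that by (metis restrict_apply')
    then show ?thesis using w(1) by blast
  qed
  ultimately show thesis using that by blast
qed

section \<open>From a form with dual bases to a Frobenius extension\<close>

lemma finsum_restrict_regular:
  assumes "ring_hom_ring R A \<iota>" "g \<in> I \<rightarrow> carrier A"
  shows "(\<Oplus>\<^bsub>restrict_scalars \<iota> (regular_bimodule A)\<^esub>i\<in>I. g i) = (\<Oplus>\<^bsub>A\<^esub>i\<in>I. g i)"
proof -
  interpret ring_hom_ring R A \<iota> by fact
  interpret M: left_module R "restrict_scalars \<iota> (regular_bimodule A)"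
    using left_module_restrict_scalars[OF assms(1) left_module_regular[OF S.ring_axioms]] .
  show ?thesis
    by (rule additive_finsum[OF M.M.abelian_group_axioms S.is_abelian_group, where f = "\<lambda>x. x"])
      (use assms(2) in \<open>auto simp: hom_def restrict_scalars_def regular_bimodule_def\<close>)
qed

text \<open>The coordinate maps \<open>E(- w j)\<close> are left linear, so \<open>v\<close> with
  these coordinates is a dual basis and yields finite generation and projectivity. The isomorphism
  is \<open>a \<mapsto> E(- a)\<close>: nondegeneracy gives injectivity, dual bases give
  surjectivity.\<close>

lemma (in frobenius_form) frobenius_extensionI:
  assumes v: "v \<in> I \<rightarrow> carrier A" and w: "w \<in> I \<rightarrow> carrier A" and "finite I"
    and dual: "\<And>x. x \<in> carrier A \<Longrightarrow> (\<Oplus>\<^bsub>A\<^esub>j\<in>I. \<iota> (E (x \<otimes>\<^bsub>A\<^esub> w j)) \<otimes>\<^bsub>A\<^esub> v j) = x"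
  shows "frobenius_extension R A \<iota>"
proof -
  let ?M = "restrict_scalars \<iota> (regular_bimodule A)"
  interpret M: left_module R ?M
    using left_module_restrict_scalars[OF ring_hom_ring_axioms left_module_regular[OF S.ring_axioms]] .
  have carrier_M: "carrier ?M = carrier A"
    and smult_M: "\<And>r x. r \<odot>\<^bsub>?M\<^esub> x = \<iota> r \<otimes>\<^bsub>A\<^esub> x"
    by (simp_all add: restrict_scalars_def regular_bimodule_def)
  have u: "(\<lambda>x. E (x \<otimes>\<^bsub>A\<^esub> w j)) \<in> left_hom R ?M (regular_bimodule R)" if "j \<in> I" for j
    using that w by (auto simp: left_hom_restrict_regular_iff form_closed form_add form_left S.l_distr S.m_assoc Pi_def)
  have dual_M: "(\<Oplus>\<^bsub>?M\<^esub>j\<in>I. E (x \<otimes>\<^bsub>A\<^esub> w j) \<odot>\<^bsub>?M\<^esub> v j) = x" if "x \<in> carrier ?M" for x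
    using that v w dual[of x] unfolding carrier_M smult_M
    by (subst finsum_restrict_regular[OF ring_hom_ring_axioms]) (auto simp: Pi_def form_closed)
  have fg: "finitely_generated R ?M"
    using v w dual_M \<open>finite I\<close>
    by (intro M.finitely_generated_of_dual_basis[of I v "\<lambda>j x. E (x \<otimes>\<^bsub>A\<^esub> w j)"])
      (auto simp: carrier_M Pi_def form_closed)
  have proj: "projective R ?M"
    by (rule M.projective_of_dual_basis[of v I "\<lambda>j x. E (x \<otimes>\<^bsub>A\<^esub> w j)"])
      (use v u dual_M in \<open>auto simp: carrier_M\<close>)
  let ?H = "left_hom R ?M (regular_bimodule R)"
  define \<Phi> where "\<Phi> a = (\<lambda>x\<in>carrier A. E (x \<otimes>\<^bsub>A\<^esub> a))" for a
  have "\<Phi> a \<in> ?H \<inter> extensional (carrier A)" if "a \<in> carrier A" for a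
    using that by (auto simp: \<Phi>_def left_hom_restrict_regular_iff form_closed form_add form_left S.l_distr S.m_assoc)
  moreover have "inj_on \<Phi> (carrier A)"
  proof (rule inj_onI)
    fix a b assume ab: "a \<in> carrier A" "b \<in> carrier A" "\<Phi> a = \<Phi> b"
    have "E (x \<otimes>\<^bsub>A\<^esub> (a \<ominus>\<^bsub>A\<^esub> b)) = \<zero>" if x: "x \<in> carrier A" for x
    proof -
      have eq: "E (x \<otimes>\<^bsub>A\<^esub> a) = E (x \<otimes>\<^bsub>A\<^esub> b)"
        using fun_cong[OF ab(3), of x] x by (simp add: \<Phi>_def)
      \<comment> \<open>Rewriting the difference as a sum makes additivity of \<open>E\<close>
        applicable; the common term \<open>E (x b)\<close> then cancels.\<close>
      have "x \<otimes>\<^bsub>A\<^esub> a = x \<otimes>\<^bsub>A\<^esub> (a \<ominus>\<^bsub>A\<^esub> b) \<oplus>\<^bsub>A\<^esub> x \<otimes>\<^bsub>A\<^esub> b"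
        using ab x by (simp add: S.minus_eq S.r_distr S.r_minus S.a_assoc S.l_neg)
      then have "E (x \<otimes>\<^bsub>A\<^esub> a) = E (x \<otimes>\<^bsub>A\<^esub> (a \<ominus>\<^bsub>A\<^esub> b)) \<oplus> E (x \<otimes>\<^bsub>A\<^esub> b)"
        using ab x by (simp add: form_add)
      then show ?thesis
        unfolding eq using ab x form_closed R.add.r_cancel_one'[of "E (x \<otimes>\<^bsub>A\<^esub> b)"] by simp
    qed
    then have "a \<ominus>\<^bsub>A\<^esub> b = \<zero>\<^bsub>A\<^esub>"
      using ab by (intro nondegenerate) auto
    then show "a = b"
      using ab(1,2) S.minus_equality[of a "\<ominus>\<^bsub>A\<^esub> b"] by (simp add: S.minus_eq)
  qed
  moreover have "f \<in> \<Phi> ` carrier A" if f: "f \<in> ?H" and ext: "f \<in> extensional (carrier A)" for f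
  proof
    have f_closed: "f x \<in> carrier R" if "x \<in> carrier A" for x
      using f that by (simp add: left_hom_restrict_regular_iff)
    have f_add: "f \<in> hom (add_monoid A) (add_monoid R)"
      using f by (auto simp: left_hom_restrict_regular_iff hom_def)
    have f_left: "f (\<iota> r \<otimes>\<^bsub>A\<^esub> x) = r \<otimes> f x" if "r \<in> carrier R" "x \<in> carrier A" for r x
      using f that by (simp add: left_hom_restrict_regular_iff)
    \<comment> \<open>Expanding \<open>x\<close> gives \<open>f x\<close> as the sum of
      \<open>E (x w\<^sub>j) f(v\<^sub>j)\<close>. Right linearity moves the scalar
      \<open>f(v\<^sub>j)\<close> inside \<open>E\<close>, which reveals the element representing
      \<open>f\<close>.\<close>
    let ?a = "\<Oplus>\<^bsub>A\<^esub>j\<in>I. w j \<otimes>\<^bsub>A\<^esub> \<iota> (f (v j))"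
    have wf: "w j \<otimes>\<^bsub>A\<^esub> \<iota> (f (v j)) \<in> carrier A" if "j \<in> I" for j
      using that v w f_closed by (auto simp: Pi_def)
    show a: "?a \<in> carrier A"
      using wf by (intro S.finsum_closed) auto
    have "f x = E (x \<otimes>\<^bsub>A\<^esub> ?a)" if x: "x \<in> carrier A" for x
    proof -
      have "f x = f (\<Oplus>\<^bsub>A\<^esub>j\<in>I. \<iota> (E (x \<otimes>\<^bsub>A\<^esub> w j)) \<otimes>\<^bsub>A\<^esub> v j)"
        using dual[OF x] by simp
      also have "\<dots> = (\<Oplus>j\<in>I. f (\<iota> (E (x \<otimes>\<^bsub>A\<^esub> w j)) \<otimes>\<^bsub>A\<^esub> v j))"
        by (rule additive_finsum[OF S.is_abelian_group R.is_abelian_group f_add])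
          (use v w x form_closed in \<open>auto simp: Pi_def\<close>)
      also have "\<dots> = (\<Oplus>j\<in>I. E (x \<otimes>\<^bsub>A\<^esub> (w j \<otimes>\<^bsub>A\<^esub> \<iota> (f (v j)))))"
        using v w x f_closed wf
        by (intro R.finsum_cong')
          (auto simp: Pi_def form_closed f_left form_right simp flip: S.m_assoc)
      also have "\<dots> = E (x \<otimes>\<^bsub>A\<^esub> ?a)"
        by (rule additive_finsum[symmetric, OF S.is_abelian_group R.is_abelian_group, where f = "\<lambda>y. E (x \<otimes>\<^bsub>A\<^esub> y)"])
          (use wf x in \<open>auto simp: hom_def form_closed form_add S.r_distr\<close>)
      finally show ?thesis .
    qed
    then show "f = \<Phi> ?a"
      using ext by (intro extensionalityI[of _ "carrier A"]) (auto simp: \<Phi>_def)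
  qed
  ultimately have bij: "bij_betw \<Phi> (carrier A) (?H \<inter> extensional (carrier A))"
    by (auto simp: bij_betw_def)
  have "bimodule_isomorphic A R (restrict_biscalars id \<iota> (regular_bimodule A))
      (Hom_bimodule R (restrict_biscalars \<iota> id (regular_bimodule A)) (regular_bimodule R))"
    unfolding frobenius_isomorphic_iff
    by (rule exI[of _ \<Phi>]) (auto simp: bij \<Phi>_def form_add form_right S.r_distr fun_eq_iff simp flip: S.m_assoc)
  then show ?thesis
    unfolding frobenius_extension_def using fg proj ring_hom_ring_axioms by blast
qed


section \<open>Corner rings\<close>

text \<open>Idempotence turns the image that defines the carrier into a fixed point condition, the
  form in which membership is checked from here on.\<close>

lemma carrier_corner_ring_iff:
  assumes "ring A" "e \<in> carrier A" "e \<otimes>\<^bsub>A\<^esub> e = e"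
  shows "x \<in> carrier (corner_ring A e) \<longleftrightarrow> x \<in> carrier A \<and> e \<otimes>\<^bsub>A\<^esub> x = x \<and> x \<otimes>\<^bsub>A\<^esub> e = x"
proof -
  interpret ring A by fact
  have "e \<otimes>\<^bsub>A\<^esub> (e \<otimes>\<^bsub>A\<^esub> a \<otimes>\<^bsub>A\<^esub> e) = e \<otimes>\<^bsub>A\<^esub> a \<otimes>\<^bsub>A\<^esub> e"
    "e \<otimes>\<^bsub>A\<^esub> a \<otimes>\<^bsub>A\<^esub> e \<otimes>\<^bsub>A\<^esub> e = e \<otimes>\<^bsub>A\<^esub> a \<otimes>\<^bsub>A\<^esub> e" if "a \<in> carrier A" for a
    using that assms(2,3) by (metis m_assoc m_closed)+
  then show ?thesis
    using assms(2) by (auto simp: corner_ring_def image_iff intro!: bexI[of _ x])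
qed

lemma corner_ring_simps [simp]:
  "mult (corner_ring A e) = mult A" "one (corner_ring A e) = e"
  "zero (corner_ring A e) = zero A" "add (corner_ring A e) = add A"
  by (simp_all add: corner_ring_def)

lemma ring_corner_ring:
  assumes "ring A" "e \<in> carrier A" "e \<otimes>\<^bsub>A\<^esub> e = e"
  shows "ring (corner_ring A e)"
proof -
  interpret ring A by fact
  note iff = carrier_corner_ring_iff[OF assms]
  have closed: "e \<otimes>\<^bsub>A\<^esub> (x \<otimes>\<^bsub>A\<^esub> y) = x \<otimes>\<^bsub>A\<^esub> y" "x \<otimes>\<^bsub>A\<^esub> y \<otimes>\<^bsub>A\<^esub> e = x \<otimes>\<^bsub>A\<^esub> y"
    if "x \<in> carrier (corner_ring A e)" "y \<in> carrier (corner_ring A e)" for x y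
    using that assms(2) m_assoc[of e x y] m_assoc[of x y e] by (auto simp: iff)
  have "subgroup (carrier (corner_ring A e)) (add_monoid A)"
    by (rule add.subgroupI)
      (use assms(2,3) in \<open>auto simp: iff r_distr l_distr l_minus r_minus simp flip: a_inv_def\<close>)
  then have "abelian_group (corner_ring A e)"
    by (rule abelian_group_restrict_carrier[OF is_abelian_group]) auto
  moreover have "monoid (corner_ring A e)"
    by (rule monoidI) (use assms(2,3) closed in \<open>auto simp: iff m_assoc\<close>)
  ultimately show ?thesis
    by (rule ringI) (auto simp: iff l_distr r_distr)
qed

lemma ring_hom_corner_ring:
  assumes "ring_hom_ring R A \<iota>" "e \<in> carrier R" "e \<otimes>\<^bsub>R\<^esub> e = e"
  shows "ring_hom_ring (corner_ring R e) (corner_ring A (\<iota> e)) \<iota>"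
proof -
  interpret ring_hom_ring R A \<iota> by fact
  have e: "\<iota> e \<in> carrier A" "\<iota> e \<otimes>\<^bsub>A\<^esub> \<iota> e = \<iota> e"
    using assms(2,3) by (simp_all flip: hom_mult)
  show ?thesis
    by (rule ring_hom_ringI)
      (use assms(2,3) e in \<open>auto simp: ring_corner_ring R.ring_axioms S.ring_axioms
        carrier_corner_ring_iff[OF R.ring_axioms] carrier_corner_ring_iff[OF S.ring_axioms] simp flip: hom_mult\<close>)
qed

section \<open>Left ideals generated by an idempotent, and their coordinates\<close>

lemma carrier_left_ideal_iff:
  assumes "ring A" "e \<in> carrier A" "e \<otimes>\<^bsub>A\<^esub> e = e"
  shows "x \<in> carrier (left_ideal_module A e) \<longleftrightarrow> x \<in> carrier A \<and> x \<otimes>\<^bsub>A\<^esub> e = x"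
proof -
  interpret ring A by fact
  show ?thesis
    using assms(2,3) by (auto simp: left_ideal_module_def image_iff m_assoc intro!: bexI[of _ x])
qed

text \<open>A linear map on \<open>Re\<close> is determined by the image of \<open>e\<close>, since
  \<open>a = a e\<close> there. So each \<open>w j\<close> from \<open>in_add_coordinates\<close> is
  multiplication by \<open>v j = w j e\<close>. This element lies in \<open>Ae\<close>, and
  \<open>e = e e\<close> shows that it is also fixed by \<open>\<iota> e\<close> on the
  left.\<close>

lemma left_ideal_coordinates:
  assumes "ring_hom_ring R A \<iota>" and e: "e \<in> carrier R" "e \<otimes>\<^bsub>R\<^esub> e = e"
    and "in_add R (left_ideal_module R e) (restrict_scalars \<iota> (left_ideal_module A (\<iota> e)))"
  obtains n u v where
    "\<And>j. j < n \<Longrightarrow> u j \<in> left_hom R (restrict_scalars \<iota> (left_ideal_module A (\<iota> e))) (left_ideal_module R e)"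
    "\<And>j. j < n \<Longrightarrow> v j \<in> carrier (corner_ring A (\<iota> e))"
    "\<And>x. x \<in> carrier (left_ideal_module A (\<iota> e)) \<Longrightarrow>
      (\<Oplus>\<^bsub>restrict_scalars \<iota> (left_ideal_module A (\<iota> e))\<^esub>j\<in>{..<n::nat}. \<iota> (u j x) \<otimes>\<^bsub>A\<^esub> v j) = x"
proof -
  interpret ring_hom_ring R A \<iota> by fact
  have \<iota>e: "\<iota> e \<in> carrier A" "\<iota> e \<otimes>\<^bsub>A\<^esub> \<iota> e = \<iota> e"
    using e by (simp_all flip: hom_mult)
  let ?M = "left_ideal_module R e" and ?N = "restrict_scalars \<iota> (left_ideal_module A (\<iota> e))"
  note M_iff = carrier_left_ideal_iff[OF R.ring_axioms e]
  note N_iff = carrier_left_ideal_iff[OF S.ring_axioms \<iota>e]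
  have M: "left_module R ?M" and N: "left_module R ?N"
    using e \<iota>e by (auto intro!: left_module_left_ideal left_module_restrict_scalars assms(1) R.ring_axioms S.ring_axioms)
  interpret M: left_module R ?M by (rule M)
  interpret N: left_module R ?N by (rule N)
  have N_carrier: "carrier ?N = carrier (left_ideal_module A (\<iota> e))"
    and N_add: "add ?N = add (left_ideal_module A (\<iota> e))"
    and N_smult: "\<And>r x. r \<odot>\<^bsub>?N\<^esub> x = \<iota> r \<otimes>\<^bsub>A\<^esub> x"
    by (simp_all add: restrict_scalars_def left_ideal_module_def)
  obtain n u w where u: "\<And>j. j < n \<Longrightarrow> u j \<in> left_hom R ?N ?M"
    and w: "\<And>j. j < n \<Longrightarrow> w j \<in> left_hom R ?M ?N"
    and sum: "\<And>x. x \<in> carrier ?N \<Longrightarrow> (\<Oplus>\<^bsub>?N\<^esub>j\<in>{..<n::nat}. w j (u j x)) = x"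
    using in_add_coordinates[OF M N assms(4)] by blast
  have e_M: "e \<in> carrier ?M"
    using e by (simp add: M_iff)
  have w_eq: "w j a = \<iota> a \<otimes>\<^bsub>A\<^esub> w j e" if "j < n" "a \<in> carrier ?M" for j a
  proof -
    have "a = a \<odot>\<^bsub>?M\<^esub> e"
      using that(2) by (simp add: M_iff) (simp add: left_ideal_module_def)
    then show ?thesis
      using left_hom_smult[OF w[OF that(1)] _ e_M, of a] that(2) by (simp add: N_smult M_iff)
  qed
  have v: "w j e \<in> carrier (corner_ring A (\<iota> e))" if "j < n" for j
    using left_hom_closed[OF w[OF that] e_M] w_eq[OF that e_M]
    by (simp add: carrier_corner_ring_iff[OF S.ring_axioms \<iota>e] N_carrier N_iff)
  have "(\<Oplus>\<^bsub>?N\<^esub>j\<in>{..<n}. \<iota> (u j x) \<otimes>\<^bsub>A\<^esub> w j e) = x"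
    if x: "x \<in> carrier (left_ideal_module A (\<iota> e))" for x
  proof -
    have u_cl: "u j x \<in> carrier ?M" if "j < n" for j
      using left_hom_closed[OF u[OF that]] x N_carrier by blast
    have "(\<Oplus>\<^bsub>?N\<^esub>j\<in>{..<n}. \<iota> (u j x) \<otimes>\<^bsub>A\<^esub> w j e) = (\<Oplus>\<^bsub>?N\<^esub>j\<in>{..<n}. w j (u j x))"
      using left_hom_closed[OF w] u_cl by (intro N.finsum_cong') (auto simp: w_eq[symmetric])
    then show ?thesis
      using sum x by (simp add: N_carrier)
  qed
  with u v show thesis
    by (rule that)
qed

theorem frobenius_extension_corner_ring:
  fixes R (structure) and A (structure)
  assumes "frobenius_extension R A \<iota>" and e: "e \<in> carrier R" "e \<otimes>\<^bsub>R\<^esub> e = e"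
    and "in_add R (left_ideal_module R e) (restrict_scalars \<iota> (left_ideal_module A (\<iota> e)))"
  shows "frobenius_extension (corner_ring R e) (corner_ring A (\<iota> e)) \<iota>"
proof -
  obtain E where "frobenius_form R A \<iota> E" and represent:
    "\<And>f. f \<in> left_hom R (restrict_scalars \<iota> (regular_bimodule A)) (regular_bimodule R) \<Longrightarrow>
      \<exists>w\<in>carrier A. \<forall>x\<in>carrier A. f x = E (x \<otimes>\<^bsub>A\<^esub> w)"
    using frobenius_extensionE[OF assms(1)] by blast
  interpret frobenius_form R A \<iota> E by fact
  define i where "i = \<iota> e"
  have i: "i \<in> carrier A" "i \<otimes>\<^bsub>A\<^esub> i = i"
    using e by (simp_all add: i_def flip: hom_mult)
  have hom: "ring_hom_ring (corner_ring R e) (corner_ring A i) \<iota>"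
    unfolding i_def using ring_hom_corner_ring[OF ring_hom_ring_axioms e] .
  interpret C: ring_hom_ring "corner_ring R e" "corner_ring A i" \<iota> by (rule hom)
  note Re_iff = carrier_corner_ring_iff[OF R.ring_axioms e]
  note Ai_iff = carrier_corner_ring_iff[OF S.ring_axioms i]
  note Le_iff = carrier_left_ideal_iff[OF R.ring_axioms e]
  note Li_iff = carrier_left_ideal_iff[OF S.ring_axioms i]
  let ?N = "restrict_scalars \<iota> (left_ideal_module A i)"
  obtain n u v where u: "\<And>j. j < n \<Longrightarrow> u j \<in> left_hom R ?N (left_ideal_module R e)"
    and v: "\<And>j. j < n \<Longrightarrow> v j \<in> carrier (corner_ring A i)"
    and sum: "\<And>x. x \<in> carrier (left_ideal_module A i) \<Longrightarrow>
      (\<Oplus>\<^bsub>?N\<^esub>j\<in>{..<n::nat}. \<iota> (u j x) \<otimes>\<^bsub>A\<^esub> v j) = x"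
    using left_ideal_coordinates[OF ring_hom_ring_axioms e assms(4)] unfolding i_def by blast
  interpret N: left_module R ?N
    using left_module_restrict_scalars[OF ring_hom_ring_axioms left_module_left_ideal[OF S.ring_axioms i(1)]] .
  have N_carrier: "carrier ?N = carrier (left_ideal_module A i)"
    and N_add: "add ?N = add A" and N_smult: "\<And>r x. r \<odot>\<^bsub>?N\<^esub> x = \<iota> r \<otimes>\<^bsub>A\<^esub> x"
    and M_add: "add (left_ideal_module R e) = add R" and M_smult: "\<And>r x. r \<odot>\<^bsub>left_ideal_module R e\<^esub> x = r \<otimes> x"
    by (simp_all add: restrict_scalars_def left_ideal_module_def)
  have u_closed: "u j x \<in> carrier R" "u j x \<otimes> e = u j x"
    if "j < n" "x \<in> carrier A" "x \<otimes>\<^bsub>A\<^esub> i = x" for j x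
    using left_hom_closed[OF u[OF that(1)], of x] that by (auto simp: N_carrier Li_iff Le_iff)
  have u_add: "u j (x \<oplus>\<^bsub>A\<^esub> y) = u j x \<oplus> u j y"
    if "j < n" "x \<in> carrier A" "x \<otimes>\<^bsub>A\<^esub> i = x" "y \<in> carrier A" "y \<otimes>\<^bsub>A\<^esub> i = y" for j x y
    using left_hom_add[OF u[OF that(1)], of x y] that by (simp add: N_carrier Li_iff N_add M_add)
  have u_smult: "u j (\<iota> r \<otimes>\<^bsub>A\<^esub> x) = r \<otimes> u j x"
    if "j < n" "r \<in> carrier R" "x \<in> carrier A" "x \<otimes>\<^bsub>A\<^esub> i = x" for j r x
    using left_hom_smult[OF u[OF that(1)], of r x] that by (simp add: N_carrier Li_iff N_smult M_smult)
  have uv_closed: "(\<lambda>j. \<iota> (u j x) \<otimes>\<^bsub>A\<^esub> v j) \<in> {..<n} \<rightarrow> carrier ?N"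
    if "x \<in> carrier (left_ideal_module A i)" for x
    using that u_closed(1) v i by (auto simp: N_carrier Li_iff Ai_iff S.m_assoc)
  \<comment> \<open>The expansion of \<open>x\<close> is a sum in the module \<open>?N\<close>. It
    is used only through additive maps out of \<open>?N\<close>: into \<open>R\<close> for
    nondegeneracy, and into the corner ring for the dual bases.\<close>
  have sum_r: "f x = (\<Oplus>j\<in>{..<n}. f (\<iota> (u j x) \<otimes>\<^bsub>A\<^esub> v j))"
    if "f \<in> hom (add_monoid ?N) (add_monoid R)" "x \<in> carrier (left_ideal_module A i)" for f x
    using additive_finsum[OF N.M.abelian_group_axioms R.is_abelian_group that(1) uv_closed[OF that(2)]]
      sum[OF that(2)] by simp
  have sum_c: "f x = (\<Oplus>\<^bsub>corner_ring A i\<^esub>j\<in>{..<n}. f (\<iota> (u j x) \<otimes>\<^bsub>A\<^esub> v j))"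
    if "f \<in> hom (add_monoid ?N) (add_monoid (corner_ring A i))" "x \<in> carrier (left_ideal_module A i)" for f x
    using additive_finsum[OF N.M.abelian_group_axioms C.S.is_abelian_group that(1) uv_closed[OF that(2)]]
      sum[OF that(2)] by simp
  have left_i: "i \<otimes>\<^bsub>A\<^esub> (i \<otimes>\<^bsub>A\<^esub> x) = i \<otimes>\<^bsub>A\<^esub> x" if "x \<in> carrier A" for x
    using that i by (simp flip: S.m_assoc)
  have right_i: "x \<otimes>\<^bsub>A\<^esub> i \<otimes>\<^bsub>A\<^esub> i = x \<otimes>\<^bsub>A\<^esub> i" if "x \<in> carrier A" for x
    using that i by (simp add: S.m_assoc)
  have "\<exists>w\<in>carrier (corner_ring A i). \<forall>x\<in>carrier (corner_ring A i). u j x = E (x \<otimes>\<^bsub>A\<^esub> w)" if j: "j < n" for j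
  proof -
    \<comment> \<open>The map \<open>u j\<close> is linear on \<open>Ai\<close> only; precomposing
      with right multiplication by \<open>i\<close> extends it to \<open>A\<close>, where it can be
      represented by the form.\<close>
    have "(\<lambda>x. u j (x \<otimes>\<^bsub>A\<^esub> i)) \<in> left_hom R (restrict_scalars \<iota> (regular_bimodule A)) (regular_bimodule R)"
      using j i by (auto simp: left_hom_restrict_regular_iff u_closed right_i u_add u_smult S.l_distr S.m_assoc)
    then obtain w where w: "w \<in> carrier A" "\<And>x. x \<in> carrier A \<Longrightarrow> u j (x \<otimes>\<^bsub>A\<^esub> i) = E (x \<otimes>\<^bsub>A\<^esub> w)"
      using represent by blast
    \<comment> \<open>Passing from \<open>w\<close> to \<open>i w i\<close> changes nothing: the
      left factor is absorbed by \<open>x = x i\<close>, and the right one leaves \<open>E\<close>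
      as a factor \<open>e\<close>, which is absorbed by \<open>u j x\<close> in
      \<open>Re\<close>.\<close>
    have "u j x = E (x \<otimes>\<^bsub>A\<^esub> (i \<otimes>\<^bsub>A\<^esub> w \<otimes>\<^bsub>A\<^esub> i))" if "x \<in> carrier (corner_ring A i)" for x
    proof -
      have x: "x \<in> carrier A" "x \<otimes>\<^bsub>A\<^esub> i = x"
        using that by (auto simp: Ai_iff)
      have "x \<otimes>\<^bsub>A\<^esub> (i \<otimes>\<^bsub>A\<^esub> w \<otimes>\<^bsub>A\<^esub> i) = (x \<otimes>\<^bsub>A\<^esub> i) \<otimes>\<^bsub>A\<^esub> w \<otimes>\<^bsub>A\<^esub> i"
        using x(1) w(1) i(1) by (simp add: S.m_assoc)
      then have "E (x \<otimes>\<^bsub>A\<^esub> (i \<otimes>\<^bsub>A\<^esub> w \<otimes>\<^bsub>A\<^esub> i)) = E (x \<otimes>\<^bsub>A\<^esub> w) \<otimes> e"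
        using x w(1) e by (simp add: i_def form_right)
      then show ?thesis
        using w(2)[OF x(1)] x u_closed(2)[OF j x] by simp
    qed
    moreover have "i \<otimes>\<^bsub>A\<^esub> w \<otimes>\<^bsub>A\<^esub> i \<in> carrier (corner_ring A i)"
      using w(1) by (auto simp: corner_ring_def)
    ultimately show ?thesis by blast
  qed
  then obtain w where w: "\<And>j. j < n \<Longrightarrow> w j \<in> carrier (corner_ring A i)"
    and uw: "\<And>j x. j < n \<Longrightarrow> x \<in> carrier (corner_ring A i) \<Longrightarrow> u j x = E (x \<otimes>\<^bsub>A\<^esub> w j)"
    by metis
  interpret C: frobenius_form "corner_ring R e" "corner_ring A i" \<iota> E
  proof
    fix x assume "x \<in> carrier (corner_ring A i)"
    then have x: "x \<in> carrier A" "\<iota> e \<otimes>\<^bsub>A\<^esub> x = x" "x \<otimes>\<^bsub>A\<^esub> \<iota> e = x"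
      by (auto simp: Ai_iff simp flip: i_def)
    \<comment> \<open>Bilinearity of \<open>E\<close> carries the fixed point conditions on
      \<open>x\<close> over to \<open>E x\<close>.\<close>
    show "E x \<in> carrier (corner_ring R e)"
      using form_left[OF e(1) x(1)] form_right[OF x(1) e(1)] x form_closed by (simp add: Re_iff)
  next
    fix y assume "y \<in> carrier (corner_ring A i)"
      and zero: "\<And>x. x \<in> carrier (corner_ring A i) \<Longrightarrow> E (x \<otimes>\<^bsub>corner_ring A i\<^esub> y) = \<zero>\<^bsub>corner_ring R e\<^esub>"
    then have y: "y \<in> carrier A" "i \<otimes>\<^bsub>A\<^esub> y = y"
      by (auto simp: Ai_iff)
    \<comment> \<open>The hypothesis on \<open>y\<close> tests only elements of \<open>iAi\<close>,
      while nondegeneracy over \<open>A\<close> tests all \<open>x\<close>. As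
      \<open>i y = y\<close>, \<open>x\<close> may be replaced by \<open>x i\<close>, whose
      expansion has coefficients that leave \<open>E\<close> and vectors \<open>v j\<close> in
      \<open>iAi\<close>, where the hypothesis applies.\<close>
    have "E (x \<otimes>\<^bsub>A\<^esub> y) = \<zero>\<^bsub>R\<^esub>" if x: "x \<in> carrier A" for x
    proof -
      let ?x = "x \<otimes>\<^bsub>A\<^esub> i"
      have xi: "?x \<in> carrier A" "?x \<otimes>\<^bsub>A\<^esub> i = ?x"
        using x i by (simp_all add: right_i)
      have "E (x \<otimes>\<^bsub>A\<^esub> y) = E (?x \<otimes>\<^bsub>A\<^esub> y)"
        using x y i by (simp add: S.m_assoc)
      also have "\<dots> = (\<Oplus>j\<in>{..<n}. E (\<iota> (u j ?x) \<otimes>\<^bsub>A\<^esub> v j \<otimes>\<^bsub>A\<^esub> y))"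
        by (rule sum_r[where f = "\<lambda>z. E (z \<otimes>\<^bsub>A\<^esub> y)"])
          (use xi y in \<open>auto simp: hom_def N_carrier Li_iff N_add form_closed form_add S.l_distr\<close>)
      also have "\<dots> = (\<Oplus>j\<in>{..<n}. \<zero>)"
      proof (rule R.finsum_cong')
        fix j assume "j \<in> {..<n}"
        then have j: "j < n" by simp
        have "E (\<iota> (u j ?x) \<otimes>\<^bsub>A\<^esub> v j \<otimes>\<^bsub>A\<^esub> y) = u j ?x \<otimes> E (v j \<otimes>\<^bsub>A\<^esub> y)"
          using u_closed(1)[OF j xi] v[OF j] y by (simp add: Ai_iff form_left S.m_assoc)
        then show "E (\<iota> (u j ?x) \<otimes>\<^bsub>A\<^esub> v j \<otimes>\<^bsub>A\<^esub> y) = \<zero>"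
          using zero[OF v[OF j]] u_closed(1)[OF j xi] by simp
      qed auto
      finally show ?thesis by simp
    qed
    then show "y = \<zero>\<^bsub>corner_ring A i\<^esub>"
      using nondegenerate[OF y(1)] by simp
  qed (auto simp: Ai_iff Re_iff form_add form_left form_right)
  have "frobenius_extension (corner_ring R e) (corner_ring A i) \<iota>"
  proof (rule C.frobenius_extensionI)
    fix x assume xC: "x \<in> carrier (corner_ring A i)"
    then have x: "x \<in> carrier A" "i \<otimes>\<^bsub>A\<^esub> x = x" "x \<otimes>\<^bsub>A\<^esub> i = x"
      by (auto simp: Ai_iff)
    \<comment> \<open>Left multiplication by \<open>i\<close> maps \<open>Ai\<close> additively to
      \<open>iAi\<close> and fixes \<open>x\<close>; it transports the expansion into the corner
      ring.\<close>
    have "i \<otimes>\<^bsub>A\<^esub> x = (\<Oplus>\<^bsub>corner_ring A i\<^esub>j\<in>{..<n}. i \<otimes>\<^bsub>A\<^esub> (\<iota> (u j x) \<otimes>\<^bsub>A\<^esub> v j))"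
      by (rule sum_c[where f = "\<lambda>z. i \<otimes>\<^bsub>A\<^esub> z"])
        (use x i in \<open>auto simp: hom_def N_carrier Li_iff N_add Ai_iff S.r_distr left_i S.m_assoc\<close>)
    also have "\<dots> = (\<Oplus>\<^bsub>corner_ring A i\<^esub>j\<in>{..<n}. \<iota> (E (x \<otimes>\<^bsub>A\<^esub> w j)) \<otimes>\<^bsub>A\<^esub> v j)"
    proof (rule C.S.finsum_cong')
      \<comment> \<open>With \<open>u j x = E (x w\<^sub>j)\<close> in \<open>eRe\<close>, each term
        already lies in \<open>iAi\<close>, so the extra factor \<open>i\<close> disappears.\<close>
      have cl: "\<iota> (E (x \<otimes>\<^bsub>A\<^esub> w j)) \<otimes>\<^bsub>A\<^esub> v j \<in> carrier (corner_ring A i)" if "j < n" for j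
        using that C.S.m_closed[OF C.hom_closed[OF C.form_closed[OF C.S.m_closed[OF xC w[OF that]]]] v[OF that]]
        by simp
      then show "(\<lambda>j. \<iota> (E (x \<otimes>\<^bsub>A\<^esub> w j)) \<otimes>\<^bsub>A\<^esub> v j) \<in> {..<n} \<rightarrow> carrier (corner_ring A i)"
        by auto
      fix j assume "j \<in> {..<n}"
      then show "i \<otimes>\<^bsub>A\<^esub> (\<iota> (u j x) \<otimes>\<^bsub>A\<^esub> v j) = \<iota> (E (x \<otimes>\<^bsub>A\<^esub> w j)) \<otimes>\<^bsub>A\<^esub> v j"
        using cl[of j] by (simp add: uw[OF _ xC] Ai_iff)
    qed simp
    finally show "(\<Oplus>\<^bsub>corner_ring A i\<^esub>j\<in>{..<n}. \<iota> (E (x \<otimes>\<^bsub>corner_ring A i\<^esub> w j)) \<otimes>\<^bsub>corner_ring A i\<^esub> v j) = x"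
      using x by simp
  qed (use v w in auto)
  then show ?thesis by (simp add: i_def)
qed

section \<open>Centrally projective extensions\<close>

text \<open>Both powers have the same operations, but the additive inverse depends on the carrier of
  the record. Negation in the power of \<open>Re\<close> is therefore expressed as the scalar
  \<open>-1\<close>, under which \<open>K\<close> is closed.\<close>

lemma subbimodule_left_ideal_power:
  assumes "ring R" and e: "e \<in> carrier R" "e \<otimes>\<^bsub>R\<^esub> e = e"
    and K: "subbimodule K R R (bimodule_power (regular_bimodule R) n)"
  shows "submodule (K \<inter> carrier (module_power (left_ideal_module R e) n)) R (module_power (left_ideal_module R e) n)"
proof -
  interpret ring R by fact
  let ?B = "bimodule_power (regular_bimodule R) n" and ?P = "module_power (left_ideal_module R e) n"
  interpret P: left_module R ?P
    using left_module_power[OF left_module_left_ideal[OF assms(1) e(1)]] .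
  have "submodule K R ?B"
    using K by (simp add: subbimodule_def)
  then have K_zero: "\<zero>\<^bsub>?B\<^esub> \<in> K"
    and K_add: "\<And>x y. x \<in> K \<Longrightarrow> y \<in> K \<Longrightarrow> x \<oplus>\<^bsub>?B\<^esub> y \<in> K"
    and K_smult: "\<And>a x. a \<in> carrier R \<Longrightarrow> x \<in> K \<Longrightarrow> a \<odot>\<^bsub>?B\<^esub> x \<in> K"
    by (auto simp: submodule_def submodule_axioms_def subgroup_def)
  have eqs: "add ?P = add ?B" "zero ?P = zero ?B" "smult ?P = smult ?B"
    by (auto simp: bimodule_power_def module_power_def module.defs bimodule.defs regular_bimodule_def left_ideal_module_def)
  have inv: "\<ominus>\<^bsub>?P\<^esub> x = \<ominus>\<^bsub>R\<^esub> \<one>\<^bsub>R\<^esub> \<odot>\<^bsub>?P\<^esub> x" if "x \<in> carrier ?P" for x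
  proof (rule P.M.minus_equality)
    have "(\<ominus>\<^bsub>R\<^esub> \<one>\<^bsub>R\<^esub> \<oplus>\<^bsub>R\<^esub> \<one>\<^bsub>R\<^esub>) \<odot>\<^bsub>?P\<^esub> x = \<zero>\<^bsub>?P\<^esub>"
      using that by (simp add: l_neg P.smult_l_null)
    then show "\<ominus>\<^bsub>R\<^esub> \<one>\<^bsub>R\<^esub> \<odot>\<^bsub>?P\<^esub> x \<oplus>\<^bsub>?P\<^esub> x = \<zero>\<^bsub>?P\<^esub>"
      using that by (simp add: P.smult_l_distr P.smult_one)
  qed (use that P.smult_closed in auto)
  show ?thesis
  proof (intro submodule.intro submodule_axioms.intro P.M.add.subgroupI)
    show "K \<inter> carrier ?P \<noteq> {}"
      using K_zero eqs P.M.zero_closed by auto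
  next
    fix x assume x: "x \<in> K \<inter> carrier ?P"
    then show "\<ominus>\<^bsub>?P\<^esub> x \<in> K \<inter> carrier ?P"
      using inv[of x] K_smult[of "\<ominus>\<^bsub>R\<^esub> \<one>\<^bsub>R\<^esub>" x] eqs P.M.a_inv_closed[of x]
      by simp
  next
    fix x y assume "x \<in> K \<inter> carrier ?P" "y \<in> K \<inter> carrier ?P"
    then show "x \<oplus>\<^bsub>?P\<^esub> y \<in> K \<inter> carrier ?P"
      using K_add[of x y] eqs P.M.a_closed[of x y] by simp
  next
    fix a x assume "a \<in> carrier R" "x \<in> K \<inter> carrier ?P"
    then show "a \<odot>\<^bsub>?P\<^esub> x \<in> K \<inter> carrier ?P"
      using K_smult[of a x] eqs P.smult_closed[of a x] by simp
  qed auto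
qed

text \<open>Both summands are stable under right multiplication by \<open>e\<close>, and the
  isomorphism commutes with it. Taking fixed points of this operation turns \<open>A\<close> into
  \<open>Ae\<close>, the power of \<open>R\<close> into that of \<open>Re\<close>, and a bimodule
  decomposition into a left module one.\<close>

lemma centrally_projective_imp_in_add:
  assumes "ring_hom_ring R A \<iota>" "centrally_projective R A \<iota>"
    and e: "e \<in> carrier R" "e \<otimes>\<^bsub>R\<^esub> e = e"
  shows "in_add R (left_ideal_module R e) (restrict_scalars \<iota> (left_ideal_module A (\<iota> e)))"
proof -
  interpret ring_hom_ring R A \<iota> by fact
  have \<iota>e: "\<iota> e \<in> carrier A" "\<iota> e \<otimes>\<^bsub>A\<^esub> \<iota> e = \<iota> e"
    using e by (simp_all flip: hom_mult)
  obtain n K where K: "bimodule_direct_summand K R R (bimodule_power (regular_bimodule R) n)"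
    and iso: "bimodule_isomorphic R R (restrict_biscalars \<iota> \<iota> (regular_bimodule A))
        ((bimodule_power (regular_bimodule R) n)\<lparr>carrier := K\<rparr>)"
    using assms(2) unfolding centrally_projective_def by blast
  define B where "B = bimodule_power (regular_bimodule R) n"
  define P where "P = module_power (left_ideal_module R e) n"
  interpret P: left_module R P
    unfolding P_def using left_module_power[OF left_module_left_ideal[OF R.ring_axioms e(1)]] .
  note le_iff = carrier_left_ideal_iff[OF R.ring_axioms e]
  note li_iff = carrier_left_ideal_iff[OF S.ring_axioms \<iota>e]
  obtain L where sK: "subbimodule K R R B" and sL: "subbimodule L R R B"
    and sum: "K <+>\<^bsub>B\<^esub> L = carrier B" and int: "K \<inter> L = {\<zero>\<^bsub>B\<^esub>}"
    using K unfolding bimodule_direct_summand_def B_def by blast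
  have mem_sum: "\<exists>k\<in>K. \<exists>l\<in>L. z = k \<oplus>\<^bsub>B\<^esub> l" if "z \<in> carrier B" for z
  proof -
    have "carrier B = (\<Union>k\<in>K. \<Union>l\<in>L. {k \<oplus>\<^bsub>B\<^esub> l})"
      using sum by (simp add: set_add_def set_mult_def)
    with that show ?thesis by blast
  qed
  have KB: "K \<subseteq> carrier B" and LB: "L \<subseteq> carrier B"
    using sK sL unfolding subbimodule_def submodule_def subgroup_def by auto
  have K_right: "x \<triangleleft>\<^bsub>B\<^esub> e \<in> K" if "x \<in> K" for x
    using sK e that unfolding subbimodule_def by blast
  have L_right: "x \<triangleleft>\<^bsub>B\<^esub> e \<in> L" if "x \<in> L" for x
    using sL e that unfolding subbimodule_def by blast
  \<comment> \<open>The power of \<open>Re\<close> is the set of tuples fixed by right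
    multiplication by \<open>e\<close>.\<close>
  have P_iff: "z \<in> carrier P \<longleftrightarrow> z \<in> carrier B \<and> z \<triangleleft>\<^bsub>B\<^esub> e = z" for z
    using e by (auto simp: P_def B_def bimodule_power_def module_power_def module.defs bimodule.defs
        le_iff PiE_iff regular_bimodule_def fun_eq_iff extensional_def)
  have right_add: "(x \<oplus>\<^bsub>B\<^esub> y) \<triangleleft>\<^bsub>B\<^esub> e = x \<triangleleft>\<^bsub>B\<^esub> e \<oplus>\<^bsub>B\<^esub> y \<triangleleft>\<^bsub>B\<^esub> e"
    if "x \<in> carrier B" "y \<in> carrier B" for x y
    using that e by (auto simp: B_def bimodule_power_def module_power_def module.defs bimodule.defs
        PiE_iff regular_bimodule_def fun_eq_iff R.l_distr)
  have right_P: "x \<triangleleft>\<^bsub>B\<^esub> e \<in> carrier P" if "x \<in> carrier B" for x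
    using that e by (auto simp: P_def B_def bimodule_power_def module_power_def module.defs bimodule.defs
        le_iff PiE_iff regular_bimodule_def fun_eq_iff R.m_assoc)
  have eqs: "add P = add B" "zero P = zero B" "smult P = smult B"
    by (auto simp: P_def B_def bimodule_power_def module_power_def module.defs bimodule.defs
        regular_bimodule_def left_ideal_module_def)
  define K' where "K' = K \<inter> carrier P"
  define L' where "L' = L \<inter> carrier P"
  have "left_direct_summand K' R P"
    unfolding left_direct_summand_def
  proof (intro conjI exI[of _ L'])
    show "submodule K' R P" "submodule L' R P"
      using sK sL subbimodule_left_ideal_power[OF R.ring_axioms e]
      unfolding K'_def L'_def P_def B_def by blast+
    show "K' <+>\<^bsub>P\<^esub> L' = carrier P"
    proof
      show "K' <+>\<^bsub>P\<^esub> L' \<subseteq> carrier P"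
        by (auto simp: K'_def L'_def set_add_def set_mult_def)
      show "carrier P \<subseteq> K' <+>\<^bsub>P\<^esub> L'"
      proof
        fix z assume z: "z \<in> carrier P"
        then obtain k l where kl: "k \<in> K" "l \<in> L" "z = k \<oplus>\<^bsub>B\<^esub> l"
          using mem_sum P_iff by blast
        \<comment> \<open>Multiplying \<open>z = k + l\<close> by \<open>e\<close> keeps
          \<open>z\<close> and moves \<open>k\<close> and \<open>l\<close> into \<open>K'\<close>
          and \<open>L'\<close>.\<close>
        have "z = z \<triangleleft>\<^bsub>B\<^esub> e"
          using z P_iff by simp
        also have "\<dots> = k \<triangleleft>\<^bsub>B\<^esub> e \<oplus>\<^bsub>P\<^esub> l \<triangleleft>\<^bsub>B\<^esub> e"
          using kl KB LB right_add eqs by auto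
        finally have "z = k \<triangleleft>\<^bsub>B\<^esub> e \<oplus>\<^bsub>P\<^esub> l \<triangleleft>\<^bsub>B\<^esub> e" .
        moreover have "k \<triangleleft>\<^bsub>B\<^esub> e \<in> K'" "l \<triangleleft>\<^bsub>B\<^esub> e \<in> L'"
          using kl KB LB K_right L_right right_P by (auto simp: K'_def L'_def)
        ultimately show "z \<in> K' <+>\<^bsub>P\<^esub> L'"
          unfolding set_add_def set_mult_def by auto
      qed
    qed
    show "K' \<inter> L' = {\<zero>\<^bsub>P\<^esub>}"
      using int eqs P.M.zero_closed by (auto simp: K'_def L'_def)
  qed
  moreover have "left_isomorphic R (restrict_scalars \<iota> (left_ideal_module A (\<iota> e))) (P\<lparr>carrier := K'\<rparr>)"
  proof -
    obtain f where f: "f \<in> left_hom R (restrict_biscalars \<iota> \<iota> (regular_bimodule A)) (B\<lparr>carrier := K\<rparr>)"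
      and bij: "bij_betw f (carrier A) K"
      and right: "\<And>a r. a \<in> carrier A \<Longrightarrow> r \<in> carrier R \<Longrightarrow> f (a \<otimes>\<^bsub>A\<^esub> \<iota> r) = f a \<triangleleft>\<^bsub>B\<^esub> r"
      using iso unfolding bimodule_isomorphic_def B_def[symmetric]
      by (auto simp: restrict_biscalars_def restrict_scalars_def regular_bimodule_def module.defs bimodule.defs)
    have f_closed: "f a \<in> K" if "a \<in> carrier A" for a
      using bij that by (auto simp: bij_betw_def)
    have f_add: "f (a \<oplus>\<^bsub>A\<^esub> b) = f a \<oplus>\<^bsub>P\<^esub> f b" if "a \<in> carrier A" "b \<in> carrier A" for a b
      using left_hom_add[OF f, of a b] that
      by (simp add: eqs restrict_biscalars_def restrict_scalars_def regular_bimodule_def module.defs bimodule.defs)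
    have f_smult: "f (\<iota> r \<otimes>\<^bsub>A\<^esub> a) = r \<odot>\<^bsub>P\<^esub> f a" if "r \<in> carrier R" "a \<in> carrier A" for r a
      using left_hom_smult[OF f, of r a] that
      by (simp add: eqs restrict_biscalars_def restrict_scalars_def regular_bimodule_def module.defs bimodule.defs)
    \<comment> \<open>Right linearity turns \<open>f a\<close> being fixed by \<open>e\<close> into
      \<open>f (a \<iota>(e)) = f a\<close>, and injectivity of \<open>f\<close> turns this into
      \<open>a \<iota>(e) = a\<close>.\<close>
    have f_K': "f a \<in> K' \<longleftrightarrow> a \<in> carrier (left_ideal_module A (\<iota> e))" if a: "a \<in> carrier A" for a
    proof -
      have "f a \<in> K' \<longleftrightarrow> f (a \<otimes>\<^bsub>A\<^esub> \<iota> e) = f a"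
        using f_closed[OF a] right[OF a e(1)] KB by (auto simp: K'_def P_iff)
      also have "\<dots> \<longleftrightarrow> a \<otimes>\<^bsub>A\<^esub> \<iota> e = a"
        using a \<iota>e inj_on_eq_iff[OF bij_betw_imp_inj_on[OF bij]] by simp
      finally show ?thesis
        using a by (simp add: li_iff)
    qed
    have sub: "carrier (left_ideal_module A (\<iota> e)) \<subseteq> carrier A"
      by (auto simp: li_iff)
    have "f ` carrier (left_ideal_module A (\<iota> e)) = K'"
    proof
      show "f ` carrier (left_ideal_module A (\<iota> e)) \<subseteq> K'"
        using f_K' sub by auto
      show "K' \<subseteq> f ` carrier (left_ideal_module A (\<iota> e))"
      proof
        fix k assume k: "k \<in> K'"
        then obtain a where "a \<in> carrier A" "k = f a"
          using bij by (auto simp: K'_def bij_betw_def)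
        then show "k \<in> f ` carrier (left_ideal_module A (\<iota> e))"
          using k f_K' by auto
      qed
    qed
    then have "bij_betw f (carrier (left_ideal_module A (\<iota> e))) K'"
      using bij sub by (auto simp: bij_betw_def intro: inj_on_subset)
    moreover have "f \<in> left_hom R (restrict_scalars \<iota> (left_ideal_module A (\<iota> e))) (P\<lparr>carrier := K'\<rparr>)"
    proof (rule left_homI)
      fix a assume "a \<in> carrier (restrict_scalars \<iota> (left_ideal_module A (\<iota> e)))"
      then have "a \<in> carrier (left_ideal_module A (\<iota> e))"
        by (simp add: restrict_scalars_def)
      then show "f a \<in> carrier (P\<lparr>carrier := K'\<rparr>)"
        using f_K' sub by auto
    next
      fix a b assume "a \<in> carrier (restrict_scalars \<iota> (left_ideal_module A (\<iota> e)))"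
        "b \<in> carrier (restrict_scalars \<iota> (left_ideal_module A (\<iota> e)))"
      then have "a \<in> carrier A" "b \<in> carrier A"
        using sub by (auto simp: restrict_scalars_def)
      then show "f (a \<oplus>\<^bsub>restrict_scalars \<iota> (left_ideal_module A (\<iota> e))\<^esub> b) = f a \<oplus>\<^bsub>P\<lparr>carrier := K'\<rparr>\<^esub> f b"
        using f_add by (simp add: restrict_scalars_def left_ideal_module_def)
    next
      fix r a assume "r \<in> carrier R" "a \<in> carrier (restrict_scalars \<iota> (left_ideal_module A (\<iota> e)))"
      then have "r \<in> carrier R" "a \<in> carrier A"
        using sub by (auto simp: restrict_scalars_def)
      then show "f (r \<odot>\<^bsub>restrict_scalars \<iota> (left_ideal_module A (\<iota> e))\<^esub> a) = r \<odot>\<^bsub>P\<lparr>carrier := K'\<rparr>\<^esub> f a"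
        using f_smult by (simp add: restrict_scalars_def left_ideal_module_def)
    qed
    ultimately show ?thesis
      unfolding left_isomorphic_def by (auto simp: restrict_scalars_def)
  qed
  ultimately show ?thesis
    unfolding in_add_def P_def by blast
qed

section \<open>Transfer to corner rings, from an add condition or from central projectivity\<close>

theorem corollary3p7:
  fixes R :: "('r, 'k) ring_scheme" and A :: "('a, 'l) ring_scheme" and \<iota> :: "'r \<Rightarrow> 'a"
  assumes "frobenius_extension R A \<iota>"
  shows "(\<forall>e\<in>carrier R. e \<otimes>\<^bsub>R\<^esub> e = e \<longrightarrow>
            in_add R (left_ideal_module R e) (restrict_scalars \<iota> (left_ideal_module A (\<iota> e))) \<longrightarrow>
            frobenius_extension (corner_ring R e) (corner_ring A (\<iota> e)) \<iota>)
       \<and> (centrally_projective R A \<iota> \<longrightarrow>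
            (\<forall>e\<in>carrier R. e \<otimes>\<^bsub>R\<^esub> e = e \<longrightarrow>
              frobenius_extension (corner_ring R e) (corner_ring A (\<iota> e)) \<iota>))"
proof (intro conjI ballI impI)
  fix e assume e: "e \<in> carrier R" "e \<otimes>\<^bsub>R\<^esub> e = e"
  {
    assume "in_add R (left_ideal_module R e) (restrict_scalars \<iota> (left_ideal_module A (\<iota> e)))"
    then show "frobenius_extension (corner_ring R e) (corner_ring A (\<iota> e)) \<iota>"
      by (rule frobenius_extension_corner_ring[OF assms e])
  next
    assume "centrally_projective R A \<iota>"
    moreover have "ring_hom_ring R A \<iota>"
      using assms by (simp add: frobenius_extension_def)
    ultimately show "frobenius_extension (corner_ring R e) (corner_ring A (\<iota> e)) \<iota>"
      by (intro frobenius_extension_corner_ring[OF assms e] centrally_projective_imp_in_add[OF _ _ e])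
  }
qed

end
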